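(* Let $1 \leq p \leq q \leq \infty$. Let $\Gamma$ be a finitely generated group with a finite normal subgroup $N$ such that $\Gamma/N$ is $\mathscr{G}_q$-approximated. If $\Gamma$ is $\mathscr{G}_p$-approximated, then $\Gamma$ is $\mathscr{G}_q$-approximated.
   Context: For $A \in M_n(\mathbb{C})$ let $|A| = \sqrt{A^*A}$. For $1 \leq p < \infty$ the (unnormalized) Schatten $p$-norm is $\|A\|_p = \operatorname{Tr}(|A|^p)^{1/p}$, and $\|A\|_\infty$ is the operator norm. For $1 \le p \le \infty$, a group $\Gamma$ is $\mathscr{G}_p$-approximated if there exist maps (not necessarily homomorphisms) $\varphi_n : \Gamma \to U(n)$, $n\in\mathbb{N}$, into the unitary groups such that $\lim_n \|\varphi_n(gh) - \varphi_n(g)\varphi_n(h)\|_p = 0$ for all $g,h \in \Gamma$ and $\liminf_n \|\varphi_n(g) - 1\|_p > 0$ for all $g \in \Gamma\setminus\{1\}$. *)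

theory Defs
  imports
    Complex_Main
    "HOL-Library.Extended_Real"
    "HOL-Library.Liminf_Limsup"
    "HOL-Analysis.L2_Norm"
    "HOL-Algebra.Coset"
    "HOL-Algebra.Generated_Groups"
    "Jordan_Normal_Form.Schur_Decomposition"
begin

definition unitary_mats :: "nat \<Rightarrow> complex mat set" where
  "unitary_mats n = {U \<in> carrier_mat n n.
     mat_adjoint U * U = 1\<^sub>m n \<and> U * mat_adjoint U = 1\<^sub>m n}"

text \<open>Continuous functional calculus for Hermitian matrices: if
  \<open>A = U diag(d) U*\<close> with \<open>U\<close> unitary and \<open>d\<close> real, then \<open>f(A) = U diag(f(d)) U*\<close>.
  The result does not depend on the choice of the diagonalisation, and a
  diagonalisation exists precisely when \<open>A\<close> is Hermitian.\<close>
definition hermitian_fun :: "(real \<Rightarrow> real) \<Rightarrow> complex mat \<Rightarrow> complex mat" where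
  "hermitian_fun f A = (THE B. \<exists>U d. U \<in> unitary_mats (dim_row A) \<and>
     A = U * mat_diag (dim_row A) (\<lambda>i. complex_of_real (d i)) * mat_adjoint U \<and>
     B = U * mat_diag (dim_row A) (\<lambda>i. complex_of_real (f (d i))) * mat_adjoint U)"

definition mat_abs :: "complex mat \<Rightarrow> complex mat" where
  "mat_abs A = hermitian_fun sqrt (mat_adjoint A * A)"

text \<open>Used below for positive semidefinite \<open>A\<close> and \<open>p > 0\<close> only; there
  \<open>0 powr p = 0\<close> is the intended value on the kernel.\<close>
definition mat_powr :: "complex mat \<Rightarrow> real \<Rightarrow> complex mat" where
  "mat_powr A p = hermitian_fun (\<lambda>x. x powr p) A"

definition mat_trace :: "'a::comm_monoid_add mat \<Rightarrow> 'a" where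
  "mat_trace A = (\<Sum>i<dim_row A. A $$ (i, i))"

definition vec_l2_norm :: "complex vec \<Rightarrow> real" where
  "vec_l2_norm v = L2_set (\<lambda>i. cmod (v $ i)) {..<dim_vec v}"

definition mat_op_norm :: "complex mat \<Rightarrow> real" where
  "mat_op_norm A = (SUP v\<in>{v \<in> carrier_vec (dim_col A). vec_l2_norm v \<le> 1}.
     vec_l2_norm (A *\<^sub>v v))"

text \<open>The unnormalised Schatten norm, for \<open>1 \<le> p \<le> \<infinity>\<close>. The trace of the positive
  semidefinite matrix \<open>|A|^p\<close> is a nonnegative real, so \<open>Re\<close> is only a coercion.\<close>
definition schatten_norm :: "ereal \<Rightarrow> complex mat \<Rightarrow> real" where
  "schatten_norm p A =
     (if p = \<infinity> then mat_op_norm A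
      else Re (mat_trace (mat_powr (mat_abs A) (real_of_ereal p))) powr (1 / real_of_ereal p))"

text \<open>The index \<open>n = 0\<close> imposes no condition: there is exactly one \<open>0 \<times> 0\<close> matrix, it
  is unitary, and both limits ignore finitely many indices. The lower limit is taken
  in \<open>ereal\<close> because the sequence need not be bounded.\<close>
definition Gp_approximated :: "ereal \<Rightarrow> ('a, 'b) monoid_scheme \<Rightarrow> bool" where
  "Gp_approximated p G \<longleftrightarrow> (\<exists>\<phi> :: nat \<Rightarrow> 'a \<Rightarrow> complex mat.
     (\<forall>n. \<forall>g\<in>carrier G. \<phi> n g \<in> unitary_mats n) \<and>
     (\<forall>g\<in>carrier G. \<forall>h\<in>carrier G.
        (\<lambda>n. schatten_norm p (\<phi> n (g \<otimes>\<^bsub>G\<^esub> h) - \<phi> n g * \<phi> n h)) \<longlonglongrightarrow> 0) \<and>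
     (\<forall>g\<in>carrier G - {\<one>\<^bsub>G\<^esub>}.
        0 < liminf (\<lambda>n. ereal (schatten_norm p (\<phi> n g - 1\<^sub>m n)))))"

definition fin_gen_group :: "('a, 'b) monoid_scheme \<Rightarrow> bool" where
  "fin_gen_group G \<longleftrightarrow> group G \<and>
     (\<exists>S. finite S \<and> S \<subseteq> carrier G \<and> generate G S = carrier G)"

end

theory Submission
  imports
    Defs
    "Jordan_Normal_Form.Spectral_Radius"
    "HOL-Algebra.Multiplicative_Group"
begin

text \<open>Let \<open>\<phi>\<^sub>n\<close> witness that \<open>\<Gamma>\<close> is approximated in the \<open>p\<close>-norm, and let \<open>\<psi>\<^sub>n\<close> witness
  that \<open>\<Gamma> Mod N\<close> is approximated in the \<open>q\<close>-norm. Schatten norms decrease in the exponent, so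
  \<open>\<phi>\<^sub>n\<close> is also asymptotically multiplicative in the \<open>q\<close>-norm; what may fail in the \<open>q\<close>-norm is
  that it separates \<open>g \<noteq> 1\<close> from \<open>1\<close>. For \<open>g \<notin> N\<close> this is repaired by adding the pulled
  back maps \<open>\<psi>\<^sub>n\<close> as a direct summand. For \<open>g \<in> N\<close> no repair is needed, because \<open>g\<close> has
  finite order: say \<open>g\<^sup>m = 1\<close>, and let \<open>U = \<phi>\<^sub>n(g)\<close>. Then \<open>U\<^sup>m\<close> is close to \<open>1\<close> in the \<open>p\<close>-norm
  while \<open>U\<close> is not. The eigenvalues of \<open>U\<close> thus cannot all be near \<open>1\<close>: near \<open>1\<close> the
  map \<open>z \<mapsto> z\<^sup>m\<close> moves points away from \<open>1\<close>. In quantitative form, an operator norm distance of at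
  most \<open>2 / m\<close> between \<open>U\<close> and \<open>1\<close> forces \<open>\<parallel>U - 1\<parallel>\<^sub>p \<le> \<parallel>U\<^sup>m - 1\<parallel>\<^sub>p\<close>
  (\<open>unitary_schatten_dist_le_power\<close>). Hence the operator norm of \<open>U - 1\<close> stays at least \<open>2 / m\<close>
  (\<open>torsion_op_norm_gap\<close>), and so does every Schatten norm, since the operator norm is the
  smallest of them.

  The argument rests on four properties of the Schatten norms: the triangle inequality,
  \<open>\<parallel>Y A X\<parallel>\<^sub>p \<le> \<parallel>A\<parallel>\<^sub>p\<close> for contractions \<open>X\<close> and \<open>Y\<close>, monotonicity in the exponent, and
  the comparison of a direct sum with its summands. The first two follow from a variational
  formula: \<open>\<parallel>A\<parallel>\<^sub>p\<close> is the largest \<open>\<ell>\<^sup>p\<close> norm of the diagonal of \<open>Y A X\<close> over all contractions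
  \<open>X\<close> and \<open>Y\<close>. The maximum is attained at the factors of a singular value decomposition, which
  also turns the functional calculus in the definition of the norm into the \<open>\<ell>\<^sup>p\<close> norm of the
  singular values, and with it gives monotonicity. Direct sums reduce to contractions, namely to
  the coordinate inclusions.\<close>

section \<open>Adjoints, inner products and contractions\<close>

lemma mat_adjoint_dim [simp]:
  "dim_row (mat_adjoint A) = dim_col A" "dim_col (mat_adjoint A) = dim_row A"
  by (auto simp: mat_adjoint_def)

lemma mat_adjoint_carrier [simp]: "A \<in> carrier_mat m n \<Longrightarrow> mat_adjoint A \<in> carrier_mat n m"
  by auto

lemma mat_adjoint_index [simp]:
  fixes A :: "complex mat"
  shows "i < dim_col A \<Longrightarrow> j < dim_row A \<Longrightarrow> mat_adjoint A $$ (i, j) = cnj (A $$ (j, i))"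
  by (simp add: mat_adjoint_def mat_of_rows_def)

lemma mat_adjoint_mult:
  fixes A B :: "complex mat"
  assumes "A \<in> carrier_mat m n" "B \<in> carrier_mat n k"
  shows "mat_adjoint (A * B) = mat_adjoint B * mat_adjoint A"
  using assms
  by (intro eq_matI) (auto simp: scalar_prod_def mult.commute)

lemma mat_adjoint_adjoint [simp]:
  fixes A :: "complex mat"
  shows "mat_adjoint (mat_adjoint A) = A"
  by (intro eq_matI) auto

lemma mat_adjoint_one [simp]: "mat_adjoint (1\<^sub>m n :: complex mat) = 1\<^sub>m n"
  by (intro eq_matI) auto

lemma mat_adjoint_zero [simp]: "mat_adjoint (0\<^sub>m m n :: complex mat) = 0\<^sub>m n m"
  by (intro eq_matI) auto

lemma dim_mat_diag [simp]: "dim_row (mat_diag n f) = n" "dim_col (mat_diag n f) = n"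
  by (auto simp: mat_diag_def)

lemma mat_adjoint_diag [simp]:
  "mat_adjoint (mat_diag n f :: complex mat) = mat_diag n (\<lambda>i. cnj (f i))"
  by (intro eq_matI) (auto simp: mat_diag_def)

lemma mat_adjoint_four_block:
  fixes A B C D :: "complex mat"
  assumes "A \<in> carrier_mat a c" "B \<in> carrier_mat a d" "C \<in> carrier_mat b c" "D \<in> carrier_mat b d"
  shows "mat_adjoint (four_block_mat A B C D) =
    four_block_mat (mat_adjoint A) (mat_adjoint C) (mat_adjoint B) (mat_adjoint D)"
  using assms by (intro eq_matI) auto

lemma vec_l2_norm_nonneg [simp]: "0 \<le> vec_l2_norm v"
  by (simp add: vec_l2_norm_def L2_set_nonneg)

lemma vec_l2_norm_power2: "(vec_l2_norm v)\<^sup>2 = (\<Sum>i<dim_vec v. (cmod (v $ i))\<^sup>2)"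
  by (simp add: vec_l2_norm_def L2_set_def sum_nonneg)

lemma cscalar_prod_self: "v \<bullet>c v = complex_of_real ((vec_l2_norm v)\<^sup>2)"
  unfolding vec_l2_norm_power2 scalar_prod_def
  by (auto simp: complex_norm_square atLeast0LessThan simp del: of_real_power intro!: sum.cong)

lemma vec_l2_norm_eq_iff:
  assumes "v \<bullet>c v = w \<bullet>c w"
  shows "vec_l2_norm v = vec_l2_norm w"
  using assms unfolding cscalar_prod_self of_real_eq_iff by simp

lemma vec_l2_norm_eq_0_iff:
  assumes "v \<in> carrier_vec n"
  shows "vec_l2_norm v = 0 \<longleftrightarrow> v = 0\<^sub>v n"
  using conjugate_square_eq_0_vec[OF assms] unfolding cscalar_prod_self by simp

lemma vec_l2_norm_zero [simp]: "vec_l2_norm (0\<^sub>v n) = 0"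
  by (simp add: vec_l2_norm_def L2_set_def)

lemma vec_l2_norm_smult: "vec_l2_norm (c \<cdot>\<^sub>v v) = cmod c * vec_l2_norm v"
  by (auto simp: vec_l2_norm_def norm_mult L2_set_right_distrib intro!: L2_set_cong)

lemma vec_l2_norm_triangle:
  assumes "v \<in> carrier_vec n" "w \<in> carrier_vec n"
  shows "vec_l2_norm (v + w) \<le> vec_l2_norm v + vec_l2_norm w"
proof -
  have "vec_l2_norm (v + w) \<le> L2_set (\<lambda>i. cmod (v $ i) + cmod (w $ i)) {..<n}"
    using assms unfolding vec_l2_norm_def by (auto intro!: L2_set_mono norm_triangle_ineq)
  also have "\<dots> \<le> vec_l2_norm v + vec_l2_norm w"
    using assms L2_set_triangle_ineq unfolding vec_l2_norm_def by auto
  finally show ?thesis .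
qed

lemma vec_Cauchy_Schwarz:
  assumes "v \<in> carrier_vec n" "w \<in> carrier_vec n"
  shows "cmod (v \<bullet>c w) \<le> vec_l2_norm v * vec_l2_norm w"
proof -
  have "cmod (v \<bullet>c w) \<le> (\<Sum>i<n. \<bar>cmod (v $ i)\<bar> * \<bar>cmod (w $ i)\<bar>)"
    using assms unfolding scalar_prod_def atLeast0LessThan
    by (auto simp: norm_mult intro!: order.trans[OF norm_sum] sum_mono)
  also have "\<dots> \<le> L2_set (\<lambda>i. cmod (v $ i)) {..<n} * L2_set (\<lambda>i. cmod (w $ i)) {..<n}"
    by (rule L2_set_mult_ineq)
  finally show ?thesis using assms by (auto simp: vec_l2_norm_def)
qed

lemma cscalar_prod_adjoint:
  fixes A :: "complex mat"
  assumes "A \<in> carrier_mat m n" "v \<in> carrier_vec n" "w \<in> carrier_vec m"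
  shows "(A *\<^sub>v v) \<bullet>c w = v \<bullet>c (mat_adjoint A *\<^sub>v w)"
proof -
  have "(A *\<^sub>v v) \<bullet>c w = (\<Sum>i<m. \<Sum>j<n. A $$ (i, j) * v $ j * cnj (w $ i))"
    using assms by (auto simp: scalar_prod_def atLeast0LessThan sum_distrib_right)
  also have "\<dots> = (\<Sum>j<n. \<Sum>i<m. A $$ (i, j) * v $ j * cnj (w $ i))"
    by (rule sum.swap)
  also have "\<dots> = v \<bullet>c (mat_adjoint A *\<^sub>v w)"
    using assms
    by (auto simp: scalar_prod_def atLeast0LessThan sum_distrib_left mult_ac intro!: sum.cong)
  finally show ?thesis .
qed

lemma vec_l2_norm_isometry:
  assumes "X \<in> carrier_mat m n" "mat_adjoint X * X = 1\<^sub>m n" "v \<in> carrier_vec n"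
  shows "vec_l2_norm (X *\<^sub>v v) = vec_l2_norm v"
proof (rule vec_l2_norm_eq_iff)
  have "(X *\<^sub>v v) \<bullet>c (X *\<^sub>v v) = v \<bullet>c (mat_adjoint X *\<^sub>v (X *\<^sub>v v))"
    using assms by (intro cscalar_prod_adjoint) auto
  also have "mat_adjoint X *\<^sub>v (X *\<^sub>v v) = v"
    using assms assoc_mult_mat_vec[of "mat_adjoint X" n m X n v] by simp
  finally show "(X *\<^sub>v v) \<bullet>c (X *\<^sub>v v) = v \<bullet>c v" .
qed

text \<open>The matrix may be rectangular, so that coordinate inclusions and compressions
  to blocks count as contractions.\<close>
definition contraction :: "complex mat \<Rightarrow> bool" where
  "contraction X \<longleftrightarrow> (\<forall>v\<in>carrier_vec (dim_col X). vec_l2_norm (X *\<^sub>v v) \<le> vec_l2_norm v)"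

lemma contractionD:
  "contraction X \<Longrightarrow> X \<in> carrier_mat m n \<Longrightarrow> v \<in> carrier_vec n \<Longrightarrow> vec_l2_norm (X *\<^sub>v v) \<le> vec_l2_norm v"
  by (auto simp: contraction_def)

lemma contraction_isometry:
  assumes "X \<in> carrier_mat m n" "mat_adjoint X * X = 1\<^sub>m n"
  shows "contraction X"
  using assms vec_l2_norm_isometry by (auto simp: contraction_def)

lemma contraction_mult:
  assumes "contraction X" "contraction Y" "X \<in> carrier_mat m n" "Y \<in> carrier_mat n k"
  shows "contraction (X * Y)"
  unfolding contraction_def
proof
  fix v :: "complex vec" assume "v \<in> carrier_vec (dim_col (X * Y))"
  then have v: "v \<in> carrier_vec k" using assms by auto
  have "vec_l2_norm (X *\<^sub>v (Y *\<^sub>v v)) \<le> vec_l2_norm (Y *\<^sub>v v)"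
    using assms v by (intro contractionD) auto
  also have "\<dots> \<le> vec_l2_norm v" using assms v by (intro contractionD)
  finally show "vec_l2_norm ((X * Y) *\<^sub>v v) \<le> vec_l2_norm v"
    using assms v by (simp add: assoc_mult_mat_vec)
qed

text \<open>Apply Cauchy-Schwarz to \<open>\<parallel>X\<^sup>* v\<parallel>\<^sup>2 = \<langle>v, X X\<^sup>* v\<rangle>\<close>, bound \<open>\<parallel>X X\<^sup>* v\<parallel>\<close> by \<open>\<parallel>X\<^sup>* v\<parallel>\<close>, and
  divide.\<close>
lemma contraction_adjoint:
  assumes "contraction X"
  shows "contraction (mat_adjoint X)"
  unfolding contraction_def
proof
  fix v :: "complex vec" assume "v \<in> carrier_vec (dim_col (mat_adjoint X))"
  then have v: "v \<in> carrier_vec (dim_row X)" by simp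
  let ?w = "mat_adjoint X *\<^sub>v v"
  have X: "X \<in> carrier_mat (dim_row X) (dim_col X)" by auto
  have w: "?w \<in> carrier_vec (dim_col X)" by (auto simp: mult_mat_vec_def)
  have "(vec_l2_norm ?w)\<^sup>2 = cmod (?w \<bullet>c ?w)"
    unfolding cscalar_prod_self by (simp add: norm_power)
  also have "?w \<bullet>c ?w = v \<bullet>c (X *\<^sub>v ?w)"
    using cscalar_prod_adjoint[OF mat_adjoint_carrier[OF X] v w] by simp
  also have "cmod \<dots> \<le> vec_l2_norm v * vec_l2_norm (X *\<^sub>v ?w)"
    using v mult_mat_vec_carrier[OF X w] by (rule vec_Cauchy_Schwarz)
  also have "\<dots> \<le> vec_l2_norm v * vec_l2_norm ?w"
    using assms X w by (intro mult_left_mono contractionD) auto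
  finally show "vec_l2_norm ?w \<le> vec_l2_norm v"
    by (cases "vec_l2_norm ?w = 0")
      (auto simp: power2_eq_square mult_le_cancel_right less_le)
qed

text \<open>A column of \<open>X\<close> is the image of a unit vector. Together with the dual bound for rows, this
  makes the matrix of the \<open>\<bar>X\<^sub>i\<^sub>k\<bar>\<^sup>2\<close> doubly substochastic.\<close>
lemma contraction_col_sum:
  assumes "contraction X" "X \<in> carrier_mat m n" "k < n"
  shows "(\<Sum>i<m. (cmod (X $$ (i, k)))\<^sup>2) \<le> 1"
proof -
  have "vec_l2_norm (X *\<^sub>v unit_vec n k) \<le> vec_l2_norm (unit_vec n k)"
    using assms by (intro contractionD) auto
  also have "(vec_l2_norm (unit_vec n k))\<^sup>2 = 1"
    unfolding vec_l2_norm_power2 using assms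
    by (simp add: unit_vec_def if_distrib[of "\<lambda>x. (cmod x)\<^sup>2"] cong: if_cong)
  then have "vec_l2_norm (unit_vec n k) = 1"
    by (metis vec_l2_norm_nonneg abs_of_nonneg power2_eq_1_iff abs_minus_cancel abs_one)
  finally have "(vec_l2_norm (X *\<^sub>v unit_vec n k))\<^sup>2 \<le> 1"
    by (simp add: power_le_one)
  then show ?thesis
    using assms unfolding vec_l2_norm_power2 by simp
qed

lemma contraction_row_sum:
  assumes "contraction X" "X \<in> carrier_mat m n" "k < m"
  shows "(\<Sum>i<n. (cmod (X $$ (k, i)))\<^sup>2) \<le> 1"
  using contraction_col_sum[OF contraction_adjoint[OF assms(1)] mat_adjoint_carrier[OF assms(2)] assms(3)] assms(2,3)
  by auto

lemma unitary_matsD: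
  assumes "U \<in> unitary_mats n"
  shows "U \<in> carrier_mat n n" "mat_adjoint U * U = 1\<^sub>m n" "U * mat_adjoint U = 1\<^sub>m n"
  using assms by (auto simp: unitary_mats_def)

lemma unitary_matsI:
  assumes "U \<in> carrier_mat n n" "mat_adjoint U * U = 1\<^sub>m n"
  shows "U \<in> unitary_mats n"
  using assms mat_mult_left_right_inverse[of "mat_adjoint U" n U] by (auto simp: unitary_mats_def)

lemma unitary_one: "1\<^sub>m n \<in> unitary_mats n"
  by (rule unitary_matsI) auto

lemma unitary_adjoint: "U \<in> unitary_mats n \<Longrightarrow> mat_adjoint U \<in> unitary_mats n"
  by (auto simp: unitary_mats_def)

lemma unitary_mult:
  assumes "U \<in> unitary_mats n" "V \<in> unitary_mats n"
  shows "U * V \<in> unitary_mats n"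
proof (rule unitary_matsI)
  note U = unitary_matsD[OF assms(1)] and V = unitary_matsD[OF assms(2)]
  show "U * V \<in> carrier_mat n n" by (rule mult_carrier_mat[OF U(1) V(1)])
  have "mat_adjoint (U * V) * (U * V) = mat_adjoint V * mat_adjoint U * (U * V)"
    using mat_adjoint_mult[OF U(1) V(1)] by simp
  also have "\<dots> = mat_adjoint V * (mat_adjoint U * (U * V))"
    using U V by (intro assoc_mult_mat[of _ n n _ n _ n]) auto
  also have "mat_adjoint U * (U * V) = mat_adjoint U * U * V"
    using U V by (intro assoc_mult_mat[symmetric, of _ n n _ n _ n]) auto
  finally show "mat_adjoint (U * V) * (U * V) = 1\<^sub>m n"
    using U V by simp
qed

lemma contraction_unitary: "U \<in> unitary_mats n \<Longrightarrow> contraction U"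
  by (auto intro!: contraction_isometry dest: unitary_matsD)

section \<open>Direct sums and diagonalisation of Hermitian matrices\<close>

definition mat_dsum :: "'a::zero mat \<Rightarrow> 'a mat \<Rightarrow> 'a mat" where
  "mat_dsum A B =
     four_block_mat A (0\<^sub>m (dim_row A) (dim_col B)) (0\<^sub>m (dim_row B) (dim_col A)) B"

lemma mat_dsum_carrier:
  "A \<in> carrier_mat m n \<Longrightarrow> B \<in> carrier_mat k l \<Longrightarrow> mat_dsum A B \<in> carrier_mat (m + k) (n + l)"
  by (auto simp: mat_dsum_def)

lemma mat_dsum_adjoint:
  fixes A B :: "complex mat"
  shows "mat_adjoint (mat_dsum A B) = mat_dsum (mat_adjoint A) (mat_adjoint B)"
  unfolding mat_dsum_def by (subst mat_adjoint_four_block) auto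

lemma mat_dsum_mult:
  fixes A B :: "complex mat"
  assumes "A \<in> carrier_mat m n" "A' \<in> carrier_mat n l" "B \<in> carrier_mat m' n'" "B' \<in> carrier_mat n' l'"
  shows "mat_dsum A B * mat_dsum A' B' = mat_dsum (A * A') (B * B')"
  using assms unfolding mat_dsum_def
  by (subst mult_four_block_mat[of _ m n _ n' _ m' _ _ l _ l']) auto

lemma mat_dsum_minus:
  fixes A B :: "complex mat"
  assumes "A \<in> carrier_mat m n" "A' \<in> carrier_mat m n" "B \<in> carrier_mat k l" "B' \<in> carrier_mat k l"
  shows "mat_dsum A B - mat_dsum A' B' = mat_dsum (A - A') (B - B')"
  using assms unfolding mat_dsum_def by (intro eq_matI) auto

lemma mat_dsum_one: "mat_dsum (1\<^sub>m m) (1\<^sub>m n) = 1\<^sub>m (m + n)"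
  unfolding mat_dsum_def by (intro eq_matI) auto

lemma mat_dsum_unitary:
  assumes "U \<in> unitary_mats m" "V \<in> unitary_mats n"
  shows "mat_dsum U V \<in> unitary_mats (m + n)"
  using unitary_matsD[OF assms(1)] unitary_matsD[OF assms(2)]
  by (intro unitary_matsI)
    (auto simp: mat_dsum_carrier mat_dsum_adjoint mat_dsum_one mat_dsum_mult[of _ m m _ m _ n n _ n])

lemma mat_diag_dsum:
  "mat_diag (m + n) f = mat_dsum (mat_diag m f) (mat_diag n (\<lambda>i. f (m + i)))"
  unfolding mat_dsum_def mat_diag_def by (intro eq_matI) auto

text \<open>Complete \<open>v\<close> to a basis and orthogonalise it; rescaling the columns then gives a unitary
  matrix. Hence an eigenvector can be made the first vector of an orthonormal basis.\<close>
lemma unitary_first_column: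
  fixes v :: "complex vec"
  assumes v: "v \<in> carrier_vec n" "v \<noteq> 0\<^sub>v n"
  obtains U c where "U \<in> unitary_mats n" "col U 0 = c \<cdot>\<^sub>v v"
proof -
  interpret cof_vec_space n "TYPE(complex)" .
  define b where "b = basis_completion v"
  define ws where "ws = gram_schmidt n b"
  define W where "W = mat_of_cols n ws"
  have n0: "n \<noteq> 0" using v by auto
  note bas = basis_completion[OF v, folded b_def]
  obtain vs where bv: "b = v # vs" using bas(6,7) n0 by (cases b) auto
  have ws: "set ws \<subseteq> carrier_vec n" "corthogonal ws" "length ws = n"
    using gram_schmidt_result[OF bas(2,4,5) refl, folded ws_def] bas(6) by auto
  have hd: "hd ws = v" using gram_schmidt_hd[OF v(1), of vs, folded bv] by (simp add: ws_def)
  have W: "W \<in> carrier_mat n n"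
    using ws mat_of_cols_carrier(1)[of n ws] by (simp add: W_def)
  have "corthogonal_mat W" unfolding W_def by (rule orthogonal_mat_of_cols[OF ws])
  then have orth: "col W i \<bullet>c col W j = 0 \<longleftrightarrow> i \<noteq> j" if "i < n" "j < n" for i j
    using corthogonal_matD[of W i j] that W by auto
  \<comment> \<open>The columns of \<open>W\<close> are nonzero and orthogonal; \<open>g\<close> normalises them.\<close>
  define g where "g i = complex_of_real (1 / vec_l2_norm (col W i))" for i
  define U where "U = W * mat_diag n g"
  have UW: "U = Matrix.mat n n (\<lambda>(i, j). W $$ (i, j) * g j)"
    unfolding U_def by (rule mat_diag_mult_right[OF W])
  have "mat_adjoint U * U = 1\<^sub>m n"
  proof (rule eq_matI)
    fix i j assume "i < dim_row (1\<^sub>m n)" "j < dim_col (1\<^sub>m n)"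
    then have ij: "i < n" "j < n" by auto
    have "(mat_adjoint U * U) $$ (i, j) = (\<Sum>k<n. cnj (W $$ (k, i) * g i) * (W $$ (k, j) * g j))"
      using ij by (simp add: UW scalar_prod_def atLeast0LessThan)
    also have "\<dots> = (\<Sum>k<n. W $$ (k, j) * cnj (W $$ (k, i))) * (g i * g j)"
      by (simp add: sum_divide_distrib g_def mult_ac)
    also have "(\<Sum>k<n. W $$ (k, j) * cnj (W $$ (k, i))) = col W j \<bullet>c col W i"
      using ij W by (auto simp: scalar_prod_def atLeast0LessThan)
    also have "(col W j \<bullet>c col W i) * (g i * g j) = (if i = j then 1 else 0)"
    proof (cases "i = j")
      case True
      have "vec_l2_norm (col W j) \<noteq> 0"
        using orth[OF ij(2) ij(2)] by (auto simp: cscalar_prod_self)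
      then show ?thesis unfolding True cscalar_prod_self g_def
        by (simp add: power2_eq_square)
    qed (use orth ij in auto)
    finally show "(mat_adjoint U * U) $$ (i, j) = 1\<^sub>m n $$ (i, j)" using ij by simp
  qed (auto simp: UW)
  then have "U \<in> unitary_mats n" by (intro unitary_matsI) (simp add: UW)
  moreover have "col W 0 = v"
    using hd hd_conv_nth[of ws] ws n0 v unfolding W_def by (subst col_mat_of_cols) auto
  then have "col U 0 = g 0 \<cdot>\<^sub>v v"
    using n0 W by (intro eq_vecI) (auto simp: UW col_def mult.commute)
  ultimately show ?thesis by (rule that)
qed

lemma mult_conjugation:
  assumes "A \<in> carrier_mat n n" "B \<in> carrier_mat n n" "D \<in> carrier_mat n n"
    "B' \<in> carrier_mat n n" "A' \<in> carrier_mat n n"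
  shows "(A * B) * D * (B' * A') = A * (B * D * B') * A'"
  using assms by (simp add: assoc_mult_mat[of _ n n _ n _ n] mult_carrier_mat[of _ n n _ n])

text \<open>Induction on the size. In an orthonormal basis that starts with an eigenvector, the first
  column of the matrix vanishes below the diagonal. Since the matrix is Hermitian, so does the first
  row to the right of the diagonal, and what remains is a smaller Hermitian block.\<close>
lemma hermitian_diagonalization:
  assumes "A \<in> carrier_mat n n" "mat_adjoint A = A"
  shows "\<exists>U d. U \<in> unitary_mats n \<and>
    A = U * mat_diag n (\<lambda>i. complex_of_real (d i)) * mat_adjoint U"
  using assms
proof (induction n arbitrary: A)
  case 0
  then show ?case using unitary_one[of 0] by (intro exI[of _ "1\<^sub>m 0"] exI[of _ "\<lambda>_. 0"] conjI eq_matI) auto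
next
  case (Suc m)
  note A = Suc.prems(1)
  obtain e where "eigenvalue A e" using spectrum_non_empty[OF A] by (auto simp: spectrum_def)
  then obtain v where v: "v \<in> carrier_vec (Suc m)" "v \<noteq> 0\<^sub>v (Suc m)" "A *\<^sub>v v = e \<cdot>\<^sub>v v"
    using A by (auto simp: eigenvalue_def eigenvector_def)
  obtain U c where U: "U \<in> unitary_mats (Suc m)" and U0: "col U 0 = c \<cdot>\<^sub>v v"
    by (rule unitary_first_column[OF v(1,2)])
  note Uc = unitary_matsD[OF U]
  define B where "B = mat_adjoint U * A * U"
  have B: "B \<in> carrier_mat (Suc m) (Suc m)"
    using A Uc by (auto simp: B_def)
  have B_adj: "mat_adjoint B = B"
  proof -
    have "mat_adjoint B = mat_adjoint U * mat_adjoint (mat_adjoint U * A)"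
      unfolding B_def using A Uc by (intro mat_adjoint_mult mult_carrier_mat) auto
    also have "mat_adjoint (mat_adjoint U * A) = A * U"
      using A Uc Suc.prems by (subst mat_adjoint_mult) auto
    also have "mat_adjoint U * (A * U) = B"
      unfolding B_def using A Uc by (intro assoc_mult_mat[symmetric]) auto
    finally show ?thesis .
  qed
  have U0c: "col U 0 \<in> carrier_vec (Suc m)" using Uc(1) by (metis carrier_matD(1) col_dim)
  have "col B 0 = (mat_adjoint U * A) *\<^sub>v col U 0"
    using A Uc unfolding B_def by (intro col_mult2) auto
  also have "\<dots> = mat_adjoint U *\<^sub>v (A *\<^sub>v col U 0)"
    using A Uc U0c by (intro assoc_mult_mat_vec) auto
  also have "A *\<^sub>v col U 0 = e \<cdot>\<^sub>v col U 0"
    using A v by (simp add: U0 mult_mat_vec smult_smult_assoc mult.commute)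
  also have "mat_adjoint U *\<^sub>v (e \<cdot>\<^sub>v col U 0) = e \<cdot>\<^sub>v (mat_adjoint U *\<^sub>v col U 0)"
    using Uc U0c by (intro mult_mat_vec) auto
  also have "mat_adjoint U *\<^sub>v col U 0 = col (mat_adjoint U * U) 0"
    using Uc(1) by (intro col_mult2[symmetric]) auto
  also have "\<dots> = unit_vec (Suc m) 0" using Uc by simp
  finally have B0: "col B 0 = e \<cdot>\<^sub>v unit_vec (Suc m) 0" .
  have col0: "B $$ (i, 0) = (if i = 0 then e else 0)" if "i < Suc m" for i
    using that B arg_cong[OF B0, of "\<lambda>w. w $ i"] by (auto simp: col_def)
  have sym: "cnj (B $$ (j, i)) = B $$ (i, j)" if "i < Suc m" "j < Suc m" for i j
    using that B mat_adjoint_index[of i B j] by (simp add: B_adj)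
  have e: "cnj e = e" using sym[of 0 0] col0[of 0] by simp
  have row0: "B $$ (0, j) = (if j = 0 then e else 0)" if "j < Suc m" for j
    using sym[of 0 j] col0[of j] that e by auto
  \<comment> \<open>In the new basis the matrix is \<open>e \<oplus> C\<close>.\<close>
  define C where "C = Matrix.mat m m (\<lambda>(i, j). B $$ (Suc i, Suc j))"
  have C: "C \<in> carrier_mat m m" by (simp add: C_def)
  have "mat_adjoint C = C" using sym by (intro eq_matI) (auto simp: C_def)
  from Suc.IH[OF C this] obtain V d where V: "V \<in> unitary_mats m"
    and CV: "C = V * mat_diag m (\<lambda>i. complex_of_real (d i)) * mat_adjoint V" by blast
  note Vc = unitary_matsD[OF V]
  define W where "W = mat_dsum (1\<^sub>m 1) V"
  have W: "W \<in> unitary_mats (Suc m)"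
    using mat_dsum_unitary[OF unitary_one[of 1] V] by (simp add: W_def)
  note Wc = unitary_matsD[OF W]
  define d' where "d' = case_nat (Re e) d"
  let ?D = "mat_diag (Suc m) (\<lambda>i. complex_of_real (d' i))"
  have Re_e: "complex_of_real (Re e) = e" using e by (metis Reals_cnj_iff of_real_Re)
  have D: "?D = mat_dsum (mat_diag 1 (\<lambda>i. e)) (mat_diag m (\<lambda>i. complex_of_real (d i)))"
    using mat_diag_dsum[of 1 m "\<lambda>i. complex_of_real (d' i)"] Re_e
    by (auto simp: d'_def mat_dsum_def mat_diag_def intro!: eq_matI split: nat.splits)
  have "W * ?D * mat_adjoint W = mat_dsum (mat_diag 1 (\<lambda>i. e)) C"
    unfolding D W_def mat_dsum_adjoint CV
    using Vc by (simp add: mat_dsum_mult[of _ 1 1 _ 1 _ m m _ m] mult_carrier_mat[of _ m m _ m]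
      left_mult_one_mat[of _ 1 1] right_mult_one_mat[of _ 1 1])
  also have "\<dots> = B"
  proof (rule eq_matI)
    fix i j assume "i < dim_row B" "j < dim_col B"
    then show "mat_dsum (mat_diag 1 (\<lambda>i. e)) C $$ (i, j) = B $$ (i, j)"
      using B col0 row0 by (auto simp: mat_dsum_def mat_diag_def C_def)
  qed (use B in \<open>auto simp: mat_dsum_def C_def mat_diag_def\<close>)
  finally have BW: "B = W * ?D * mat_adjoint W" by simp
  have "(U * W) * ?D * mat_adjoint (U * W) = U * B * mat_adjoint U"
    unfolding BW using Uc Wc
    by (simp add: mat_adjoint_mult[of U "Suc m" "Suc m" W "Suc m"] mult_conjugation[of _ "Suc m"])
  also have "\<dots> = (U * mat_adjoint U) * A * (U * mat_adjoint U)"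
    unfolding B_def using Uc(1) A by (subst mult_conjugation[of _ "Suc m"]) auto
  also have "\<dots> = A" using Uc A by simp
  finally show ?case using unitary_mult[OF U W] by metis
qed

section \<open>Singular values and the Schatten norms\<close>

lemma mat_diag_conj_unitary:
  assumes "U \<in> unitary_mats n" "D \<in> carrier_mat n n" "A = U * D * mat_adjoint U"
  shows "mat_adjoint U * A * U = D" "A \<in> carrier_mat n n"
proof -
  note U = unitary_matsD[OF assms(1)]
  have "mat_adjoint U * A * U = (mat_adjoint U * U) * D * (mat_adjoint U * U)"
    unfolding assms(3) using U(1) assms(2) by (intro mult_conjugation[of _ n, symmetric]) auto
  then show "mat_adjoint U * A * U = D" using U assms(2) by simp
  show "A \<in> carrier_mat n n" unfolding assms(3) using U(1) assms(2) by auto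
qed

lemma unitary_cancel_left:
  assumes "U \<in> unitary_mats n" "A \<in> carrier_mat n k"
  shows "mat_adjoint U * (U * A) = A" "U * (mat_adjoint U * A) = A"
proof -
  note U = unitary_matsD[OF assms(1)]
  show "mat_adjoint U * (U * A) = A" "U * (mat_adjoint U * A) = A"
    using U assms(2) by (simp_all add: assoc_mult_mat[symmetric, of _ n n _ n _ k])
qed

lemma unitary_cancel_right:
  assumes "U \<in> unitary_mats n" "A \<in> carrier_mat k n"
  shows "A * U * mat_adjoint U = A" "A * mat_adjoint U * U = A"
proof -
  note U = unitary_matsD[OF assms(1)]
  show "A * U * mat_adjoint U = A" "A * mat_adjoint U * U = A"
    using U assms(2) by (simp_all add: assoc_mult_mat[of _ k n _ n _ n])
qed

text \<open>The value does not depend on the diagonalisation: if \<open>U diag(d) U\<^sup>* = V diag(e) V\<^sup>*\<close>, then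
  \<open>W = V\<^sup>* U\<close> satisfies \<open>W\<^sub>i\<^sub>j d\<^sub>j = e\<^sub>i W\<^sub>i\<^sub>j\<close>. Where \<open>W\<^sub>i\<^sub>j \<noteq> 0\<close> this says \<open>d\<^sub>j = e\<^sub>i\<close>, so the same
  relation holds for \<open>f(d\<^sub>j)\<close> and \<open>f(e\<^sub>i)\<close>.\<close>
lemma hermitian_fun_eq:
  assumes U: "U \<in> unitary_mats n"
    and A: "A = U * mat_diag n (\<lambda>i. complex_of_real (d i)) * mat_adjoint U"
  shows "hermitian_fun f A = U * mat_diag n (\<lambda>i. complex_of_real (f (d i))) * mat_adjoint U"
proof -
  note Uc = unitary_matsD[OF U]
  let ?D = "\<lambda>d. mat_diag n (\<lambda>i. complex_of_real (d i))"
  have Ac: "A \<in> carrier_mat n n" by (rule mat_diag_conj_unitary[OF U _ A]) simp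
  have dim: "dim_row A = n" using Ac by auto
  show ?thesis
    unfolding hermitian_fun_def dim
  proof (rule the_equality)
    show "\<exists>U' d'. U' \<in> unitary_mats n \<and> A = U' * ?D d' * mat_adjoint U' \<and>
       U * ?D (\<lambda>i. f (d i)) * mat_adjoint U = U' * ?D (\<lambda>i. f (d' i)) * mat_adjoint U'"
      using U A by blast
  next
    fix B
    assume "\<exists>V e. V \<in> unitary_mats n \<and> A = V * ?D e * mat_adjoint V \<and>
       B = V * ?D (\<lambda>i. f (e i)) * mat_adjoint V"
    then obtain V e where V: "V \<in> unitary_mats n" and AV: "A = V * ?D e * mat_adjoint V"
      and BV: "B = V * ?D (\<lambda>i. f (e i)) * mat_adjoint V" by blast
    note Vc = unitary_matsD[OF V]
    define W where "W = mat_adjoint V * U"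
    have W: "W \<in> carrier_mat n n" using Uc(1) Vc(1) by (auto simp: W_def)
    have VW: "V * W = U" unfolding W_def by (rule unitary_cancel_left(2)[OF V Uc(1)])
    have WU: "W * mat_adjoint U = mat_adjoint V"
      unfolding W_def using Vc(1) by (intro unitary_cancel_right(1)[OF U]) auto
    have "W * ?D d = mat_adjoint V * (U * ?D d)"
      unfolding W_def using Uc(1) Vc(1) by (intro assoc_mult_mat[of _ n n _ n _ n]) auto
    also have "U * ?D d = A * U"
      unfolding A using Uc(1) by (intro unitary_cancel_right(2)[OF U, symmetric] mult_carrier_mat) auto
    also have "A * U = V * (?D e * mat_adjoint V) * U"
      unfolding AV using Vc(1) by (subst assoc_mult_mat[of V n n _ n _ n]) auto
    also have "\<dots> = V * (?D e * W)"
      unfolding W_def using Uc(1) Vc(1)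
      by (simp add: assoc_mult_mat[of _ n n _ n _ n] mult_carrier_mat[of _ n n _ n])
    also have "mat_adjoint V * \<dots> = ?D e * W"
      using W by (intro unitary_cancel_left(1)[OF V] mult_carrier_mat) auto
    finally have "W * ?D d = ?D e * W" .
    then have eq: "W $$ (i, j) * complex_of_real (d j) = complex_of_real (e i) * W $$ (i, j)"
      if "i < n" "j < n" for i j
      using that unfolding mat_diag_mult_left[OF W] mat_diag_mult_right[OF W]
      by (metis (no_types, lifting) index_mat(1) case_prod_conv)
    then have "W $$ (i, j) * complex_of_real (f (d j)) = complex_of_real (f (e i)) * W $$ (i, j)"
      if "i < n" "j < n" for i j
      using eq[OF that] by (cases "W $$ (i, j) = 0") auto
    then have "W * ?D (\<lambda>i. f (d i)) = ?D (\<lambda>i. f (e i)) * W"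
      unfolding mat_diag_mult_left[OF W] mat_diag_mult_right[OF W]
      by (intro eq_matI) simp_all
    then have "U * ?D (\<lambda>i. f (d i)) * mat_adjoint U = V * (?D (\<lambda>i. f (e i)) * W) * mat_adjoint U"
      using Vc(1) W VW assoc_mult_mat[of V n n W n "?D (\<lambda>i. f (d i))" n] by simp
    also have "\<dots> = V * (?D (\<lambda>i. f (e i)) * (W * mat_adjoint U))"
      using Vc(1) Uc(1) W
      by (simp add: assoc_mult_mat[of _ n n _ n _ n] mult_carrier_mat[of _ n n _ n])
    also have "\<dots> = B"
      unfolding WU BV using Vc(1) by (intro assoc_mult_mat[symmetric]) auto
    finally show "B = U * ?D (\<lambda>i. f (d i)) * mat_adjoint U" by simp
  qed
qed

lemma mat_trace_commute:
  fixes A B :: "complex mat"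
  assumes "A \<in> carrier_mat m n" "B \<in> carrier_mat n m"
  shows "mat_trace (A * B) = mat_trace (B * A)"
proof -
  have "mat_trace (A * B) = (\<Sum>i<m. \<Sum>j<n. A $$ (i, j) * B $$ (j, i))"
    using assms by (simp add: mat_trace_def scalar_prod_def atLeast0LessThan)
  also have "\<dots> = (\<Sum>j<n. \<Sum>i<m. A $$ (i, j) * B $$ (j, i))" by (rule sum.swap)
  also have "\<dots> = mat_trace (B * A)"
    using assms by (simp add: mat_trace_def scalar_prod_def atLeast0LessThan mult.commute)
  finally show ?thesis .
qed

lemma mat_trace_unitary_diag:
  assumes "U \<in> unitary_mats n"
  shows "mat_trace (U * mat_diag n f * mat_adjoint U) = (\<Sum>i<n. f i)"
proof -
  note U = unitary_matsD[OF assms]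
  have "mat_trace (U * mat_diag n f * mat_adjoint U) = mat_trace (mat_adjoint U * (U * mat_diag n f))"
    using U(1) by (intro mat_trace_commute[of _ n n]) auto
  also have "mat_adjoint U * (U * mat_diag n f) = mat_diag n f"
    by (rule unitary_cancel_left(1)[OF assms mat_diag_dim])
  finally show ?thesis by (simp add: mat_trace_def mat_diag_def)
qed

lemma contraction_if_gram_diag:
  assumes X: "X \<in> carrier_mat m n" and gram: "mat_adjoint X * X = mat_diag n (\<lambda>i. complex_of_real (g i))"
    and g: "\<And>i. i < n \<Longrightarrow> g i \<le> 1"
  shows "contraction X"
  unfolding contraction_def
proof
  fix v :: "complex vec" assume "v \<in> carrier_vec (dim_col X)"
  then have v: "v \<in> carrier_vec n" using X by auto
  have "complex_of_real ((vec_l2_norm (X *\<^sub>v v))\<^sup>2) = v \<bullet>c (mat_adjoint X *\<^sub>v (X *\<^sub>v v))"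
    unfolding cscalar_prod_self[symmetric] using X v by (intro cscalar_prod_adjoint) auto
  also have "mat_adjoint X *\<^sub>v (X *\<^sub>v v) = mat_diag n (\<lambda>i. complex_of_real (g i)) *\<^sub>v v"
    using assoc_mult_mat_vec[of "mat_adjoint X" n m X n v] X v gram by simp
  also have "\<dots> = vec n (\<lambda>i. complex_of_real (g i) * v $ i)"
    using v by (intro eq_vecI) (auto simp: mat_diag_def scalar_prod_def
      if_distrib[of "\<lambda>x. x * _"] cong: if_cong)
  also have "v \<bullet>c \<dots> = complex_of_real (\<Sum>i<n. g i * (cmod (v $ i))\<^sup>2)"
    using v unfolding scalar_prod_def
    by (auto simp: atLeast0LessThan complex_norm_square mult_ac simp del: of_real_power intro!: sum.cong)
  finally have "(vec_l2_norm (X *\<^sub>v v))\<^sup>2 = (\<Sum>i<n. g i * (cmod (v $ i))\<^sup>2)"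
    unfolding of_real_eq_iff .
  also have "\<dots> \<le> (\<Sum>i<n. (cmod (v $ i))\<^sup>2)"
    using mult_right_mono[OF g] by (intro sum_mono) fastforce
  also have "\<dots> = (vec_l2_norm v)\<^sup>2" using v by (simp add: vec_l2_norm_power2)
  finally show "vec_l2_norm (X *\<^sub>v v) \<le> vec_l2_norm v"
    by (rule power2_le_imp_le) simp
qed

text \<open>Diagonalise \<open>A\<^sup>* A = U diag(d) U\<^sup>*\<close> and let \<open>s = \<surd>d\<close>. The columns of \<open>A U\<close> are
  orthogonal of lengths \<open>s\<^sub>i\<close>. Dividing each nonzero one by its length gives a partial isometry \<open>F\<close>,
  hence a contraction. The identity for \<open>F\<^sup>* A Q\<^sup>*\<close> serves to attain the maximum in the variational formula, and the last one
  evaluates the functional calculus in the definition of the Schatten norm.\<close>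
lemma singular_value_decomposition:
  assumes A: "A \<in> carrier_mat m n"
  obtains F Q s where
    "F \<in> carrier_mat m n" "Q \<in> unitary_mats n" "contraction F" "\<And>i. i < n \<Longrightarrow> 0 \<le> s i"
    "A = F * mat_diag n (\<lambda>i. complex_of_real (s i)) * Q"
    "mat_adjoint F * A * mat_adjoint Q = mat_diag n (\<lambda>i. complex_of_real (s i))"
    "\<And>p. schatten_norm (ereal p) A = (\<Sum>i<n. s i powr p) powr (1 / p)"
proof -
  define G where "G = mat_adjoint A * A"
  have G: "G \<in> carrier_mat n n" using A by (simp add: G_def mult_carrier_mat[of _ n m _ n])
  have "mat_adjoint G = G"
    unfolding G_def using A by (subst mat_adjoint_mult[of _ n m _ n]) auto
  then obtain U d where U: "U \<in> unitary_mats n"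
    and GU: "G = U * mat_diag n (\<lambda>i. complex_of_real (d i)) * mat_adjoint U"
    using hermitian_diagonalization[OF G] by blast
  note Uc = unitary_matsD[OF U]
  define s where "s i = sqrt (d i)" for i
  define Z where "Z = A * U"
  have Z: "Z \<in> carrier_mat m n" using A Uc by (simp add: Z_def)
  have "mat_adjoint Z * Z = mat_adjoint U * mat_adjoint A * (A * U)"
    unfolding Z_def using A Uc by (subst mat_adjoint_mult[of A m n U n]) auto
  also have "\<dots> = mat_adjoint U * (mat_adjoint A * (A * U))"
    using A Uc by (intro assoc_mult_mat) auto
  also have "mat_adjoint A * (A * U) = G * U"
    unfolding G_def using A Uc by (intro assoc_mult_mat[symmetric]) auto
  also have "mat_adjoint U * (G * U) = mat_adjoint U * G * U"
    using G Uc by (intro assoc_mult_mat[symmetric]) auto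
  also have "\<dots> = mat_diag n (\<lambda>i. complex_of_real (d i))"
    by (rule mat_diag_conj_unitary[OF U _ GU]) simp
  finally have ZZ: "mat_adjoint Z * Z = mat_diag n (\<lambda>i. complex_of_real (d i))" .
  have d: "d i = (\<Sum>k<m. (cmod (Z $$ (k, i)))\<^sup>2)" if "i < n" for i
  proof -
    have "complex_of_real (d i) = (mat_adjoint Z * Z) $$ (i, i)"
      using that by (simp add: ZZ mat_diag_def)
    also have "\<dots> = complex_of_real (\<Sum>k<m. (cmod (Z $$ (k, i)))\<^sup>2)"
      using that Z by (auto simp: scalar_prod_def atLeast0LessThan complex_norm_square mult_ac
        simp del: of_real_power intro!: sum.cong)
    finally show ?thesis unfolding of_real_eq_iff .
  qed
  have d0: "0 \<le> d i" if "i < n" for i unfolding d[OF that] by (simp add: sum_nonneg)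
  have Z0: "Z $$ (k, i) = 0" if "i < n" "s i = 0" "k < m" for k i
  proof -
    have "d i = 0" using that by (simp add: s_def)
    then show ?thesis using that d[OF that(1)] by (simp add: sum_nonneg_eq_0_iff)
  qed
  let ?S = "mat_diag n (\<lambda>i. complex_of_real (s i))"
  let ?T = "mat_diag n (\<lambda>i. complex_of_real (1 / s i))"
  \<comment> \<open>Where \<open>s i = 0\<close>, the convention \<open>1 / 0 = 0\<close> makes the \<open>i\<close>-th column of \<open>F\<close> zero.\<close>
  define F where "F = Z * ?T"
  have F: "F \<in> carrier_mat m n" using Z by (simp add: F_def)
  have Fadj: "mat_adjoint F = ?T * mat_adjoint Z"
    unfolding F_def using Z by (subst mat_adjoint_mult[of Z m n _ n]) auto
  have FZ: "mat_adjoint F * Z = ?S"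
  proof -
    have "mat_adjoint F * Z = ?T * (mat_adjoint Z * Z)"
      unfolding Fadj using Z by (intro assoc_mult_mat) auto
    also have "\<dots> = ?S" unfolding ZZ mat_diag_diag
    proof (rule eq_matI)
      fix i j assume "i < dim_row ?S" "j < dim_col ?S"
      then have "i < n" "j < n" by (auto simp: mat_diag_def)
      then show "mat_diag n (\<lambda>i. complex_of_real (1 / s i) * complex_of_real (d i)) $$ (i, j) = ?S $$ (i, j)"
        using d0[of j] unfolding of_real_mult[symmetric]
        by (auto simp: mat_diag_def s_def real_div_sqrt simp del: of_real_mult of_real_divide)
    qed (auto simp: mat_diag_def)
    finally show ?thesis .
  qed
  have "mat_adjoint F * F = ?S * ?T"
    using assoc_mult_mat[of "mat_adjoint F" n m Z n ?T n] F Z FZ by (simp add: F_def)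
  also have "\<dots> = mat_diag n (\<lambda>i. complex_of_real (s i * (1 / s i)))"
    by (simp only: mat_diag_diag of_real_mult)
  finally have "contraction F"
    by (rule contraction_if_gram_diag[OF F]) auto
  moreover have "F * ?S = Z * mat_diag n (\<lambda>i. complex_of_real (1 / s i) * complex_of_real (s i))"
    unfolding F_def assoc_mult_mat[OF Z mat_diag_dim mat_diag_dim] mat_diag_diag ..
  then have "F * ?S = Z"
    unfolding mat_diag_mult_right[OF Z]
    using Z Z0 by (intro eq_matI) (auto simp: of_real_mult[symmetric] simp del: of_real_mult)
  then have "F * ?S * mat_adjoint U = A"
    using A unfolding Z_def by (simp add: unitary_cancel_right(1)[OF U])
  moreover have "mat_adjoint F * A * mat_adjoint (mat_adjoint U) = ?S"
    using FZ assoc_mult_mat[of "mat_adjoint F" n m A n U n] A F Uc by (simp add: Z_def)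
  moreover have "schatten_norm (ereal p) A = (\<Sum>i<n. s i powr p) powr (1 / p)" for p
  proof -
    have abs: "mat_abs A = U * ?S * mat_adjoint U"
      unfolding mat_abs_def G_def[symmetric] s_def by (rule hermitian_fun_eq[OF U GU])
    have "mat_powr (mat_abs A) p =
        U * mat_diag n (\<lambda>i. complex_of_real (s i powr p)) * mat_adjoint U"
      unfolding mat_powr_def by (rule hermitian_fun_eq[OF U abs])
    then show ?thesis by (simp add: schatten_norm_def mat_trace_unitary_diag[OF U])
  qed
  ultimately show ?thesis
    using that[of F "mat_adjoint U" s] F unitary_adjoint[OF U] d0 by (auto simp: s_def)
qed

section \<open>Inequalities for power sums\<close>

text \<open>The graph of the convex function \<open>t \<mapsto> t powr p\<close> lies above its tangent at \<open>u\<close>, the boundary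
  point \<open>0\<close> included.\<close>
lemma powr_above_tangent:
  fixes p u x :: real
  assumes "1 \<le> p" "0 < u" "0 \<le> x"
  shows "u powr p + p * u powr (p - 1) * (x - u) \<le> x powr p"
proof (cases "x = 0")
  case True
  have "u powr (p - 1) * u = u powr p" using assms by (simp add: powr_mult_base mult.commute)
  then have "u powr p + p * u powr (p - 1) * (x - u) = (1 - p) * u powr p"
    using True by (simp add: algebra_simps)
  also have "\<dots> \<le> 0" using assms by (simp add: mult_nonpos_nonneg)
  finally show ?thesis using True by simp
next
  case False
  then have x: "0 < x" using assms by simp
  have der: "((\<lambda>t. t powr p - p * u powr (p - 1) * t) has_real_derivative
      p * t powr (p - 1) - p * u powr (p - 1)) (at t)" if "0 < t" for t
    using that by (auto intro!: derivative_eq_intros)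
  let ?h = "\<lambda>t. t powr p - p * u powr (p - 1) * t"
  have mono: "p * a powr (p - 1) \<le> p * b powr (p - 1)" if "0 < a" "a \<le> b" for a b
    using that assms by (intro mult_left_mono powr_mono2) auto
  show ?thesis
  proof (cases "u \<le> x")
    case True
    have "u powr p - p * u powr (p - 1) * u \<le> x powr p - p * u powr (p - 1) * x"
    proof (rule DERIV_nonneg_imp_nondecreasing[OF True])
      fix t assume "u \<le> t" "t \<le> x"
      then show "\<exists>y. (?h has_real_derivative y) (at t) \<and> 0 \<le> y"
        using der[of t] mono[of u t] assms(2) by (intro exI conjI) auto
    qed
    then show ?thesis by (simp add: algebra_simps)
  next
    case False
    have "u powr p - p * u powr (p - 1) * u \<le> x powr p - p * u powr (p - 1) * x"
    proof (rule DERIV_nonpos_imp_nonincreasing[of x u])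
      fix t assume "x \<le> t" "t \<le> u"
      then show "\<exists>y. (?h has_real_derivative y) (at t) \<and> y \<le> 0"
        using der[of t] mono[of t u] x by (intro exI conjI) auto
    qed (use False in simp)
    then show ?thesis by (simp add: algebra_simps)
  qed
qed

text \<open>Jensen's inequality for weights of total mass at most one. The deficit is harmless because
  the intercept \<open>(1 - p) u powr p\<close> of the tangent at \<open>u\<close> is not positive.\<close>
lemma powr_Jensen_subprob:
  fixes p :: real
  assumes p: "1 \<le> p" and w: "\<And>k. k \<in> K \<Longrightarrow> 0 \<le> w k" "(\<Sum>k\<in>K. w k) \<le> 1"
    and x: "\<And>k. k \<in> K \<Longrightarrow> 0 \<le> x k"
  shows "(\<Sum>k\<in>K. w k * x k) powr p \<le> (\<Sum>k\<in>K. w k * x k powr p)"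
proof -
  define u where "u = (\<Sum>k\<in>K. w k * x k)"
  have "0 \<le> u" using w x by (auto simp: u_def intro!: sum_nonneg)
  show ?thesis
  proof (cases "u = 0")
    case True
    then show ?thesis using w x by (auto simp: u_def[symmetric] intro!: sum_nonneg)
  next
    case False
    then have u: "0 < u" using \<open>0 \<le> u\<close> by simp
    have u': "u powr (p - 1) * u = u powr p" using u by (simp add: powr_mult_base mult.commute)
    have "u powr p = u powr p * (1 - p) + p * u powr (p - 1) * u"
      using u' by (simp add: algebra_simps)
    also have "\<dots> \<le> u powr p * (1 - p) * (\<Sum>k\<in>K. w k) + p * u powr (p - 1) * u"
      using p w mult_left_mono_neg[of "sum w K" 1 "u powr p * (1 - p)"]
      by (simp add: mult_nonneg_nonpos)
    also have "\<dots> = (\<Sum>k\<in>K. w k * (u powr p + p * u powr (p - 1) * (x k - u)))"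
    proof -
      have "w k * (u powr p + p * u powr (p - 1) * (x k - u)) =
          u powr p * (1 - p) * w k + p * u powr (p - 1) * (w k * x k)" for k
        unfolding u'[symmetric] by (simp add: algebra_simps)
      then show ?thesis by (simp add: sum.distrib sum_distrib_left[symmetric] u_def[symmetric])
    qed
    also have "\<dots> \<le> (\<Sum>k\<in>K. w k * x k powr p)"
      using p u w x by (intro sum_mono mult_left_mono powr_above_tangent) auto
    finally show ?thesis by (simp add: u_def)
  qed
qed

text \<open>With \<open>a\<close> and \<open>b\<close> the norms of \<open>f\<close> and \<open>g\<close>, the function \<open>(f + g) / (a + b)\<close> is the convex
  combination of the normalised functions \<open>f / a\<close> and \<open>g / b\<close> with weights \<open>a / (a + b)\<close> and
  \<open>b / (a + b)\<close>.\<close>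
lemma powr_sum_Minkowski:
  fixes f g :: "'i \<Rightarrow> real"
  assumes p: "1 \<le> p" and I: "finite I"
    and f: "\<And>i. i \<in> I \<Longrightarrow> 0 \<le> f i" and g: "\<And>i. i \<in> I \<Longrightarrow> 0 \<le> g i"
  shows "(\<Sum>i\<in>I. (f i + g i) powr p) powr (1 / p)
    \<le> (\<Sum>i\<in>I. f i powr p) powr (1 / p) + (\<Sum>i\<in>I. g i powr p) powr (1 / p)"
proof -
  define a where "a = (\<Sum>i\<in>I. f i powr p) powr (1 / p)"
  define b where "b = (\<Sum>i\<in>I. g i powr p) powr (1 / p)"
  have ap: "a powr p = (\<Sum>i\<in>I. f i powr p)" and bp: "b powr p = (\<Sum>i\<in>I. g i powr p)"
    using p by (simp_all add: a_def b_def powr_powr sum_nonneg)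
  have ab0: "0 \<le> a" "0 \<le> b" by (simp_all add: a_def b_def)
  show ?thesis
  proof (cases "a = 0 \<or> b = 0")
    case True
    then show ?thesis
    proof
      assume "a = 0"
      then have "f i = 0" if "i \<in> I" for i using ap I that by (simp add: sum_nonneg_eq_0_iff)
      then show ?thesis by simp
    next
      assume "b = 0"
      then have "g i = 0" if "i \<in> I" for i using bp I that by (simp add: sum_nonneg_eq_0_iff)
      then show ?thesis by simp
    qed
  next
    case False
    then have ab: "0 < a" "0 < b" using ab0 by auto
    have "(f i + g i) powr p \<le>
        (a + b) powr p * (a / (a + b) * (f i powr p / a powr p) + b / (a + b) * (g i powr p / b powr p))"
      if "i \<in> I" for i
    proof -
      let ?w = "\<lambda>t. if t then a / (a + b) else b / (a + b)" and ?x = "\<lambda>t. if t then f i / a else g i / b"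
      have "(\<Sum>t\<in>UNIV. ?w t * ?x t) powr p \<le> (\<Sum>t\<in>UNIV. ?w t * ?x t powr p)"
        using ab f[OF that] g[OF that]
        by (intro powr_Jensen_subprob[OF p]) (auto simp: UNIV_bool add_divide_distrib[symmetric])
      then have "(f i / (a + b) + g i / (a + b)) powr p \<le>
          a / (a + b) * (f i powr p / a powr p) + b / (a + b) * (g i powr p / b powr p)"
        using ab f[OF that] g[OF that] by (simp add: UNIV_bool powr_divide add.commute)
      also have "f i / (a + b) + g i / (a + b) = (f i + g i) / (a + b)"
        by (simp add: add_divide_distrib)
      finally show ?thesis
        using ab f[OF that] g[OF that] by (simp add: powr_divide field_simps)
    qed
    then have "(\<Sum>i\<in>I. (f i + g i) powr p) \<le> (\<Sum>i\<in>I. (a + b) powr p *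
        (a / (a + b) * (f i powr p / a powr p) + b / (a + b) * (g i powr p / b powr p)))"
      by (rule sum_mono)
    also have "\<dots> = (a + b) powr p * (a / (a + b) * ((\<Sum>i\<in>I. f i powr p) / a powr p)
        + b / (a + b) * ((\<Sum>i\<in>I. g i powr p) / b powr p))"
      by (simp only: sum_distrib_left[symmetric] sum.distrib sum_divide_distrib)
    also have "\<dots> = (a + b) powr p"
      using ab unfolding ap[symmetric] bp[symmetric] by (simp add: add_divide_distrib[symmetric])
    finally have "(\<Sum>i\<in>I. (f i + g i) powr p) powr (1 / p) \<le> ((a + b) powr p) powr (1 / p)"
      using p by (intro powr_mono2) (auto intro: sum_nonneg)
    also have "\<dots> = a + b" using p ab by (simp add: powr_powr)
    finally show ?thesis by (simp add: a_def b_def)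
  qed
qed

lemma le_powr_sum:
  fixes s :: "'i \<Rightarrow> real"
  assumes "1 \<le> p" "finite I" "i \<in> I" "0 \<le> s i"
  shows "s i \<le> (\<Sum>i\<in>I. s i powr p) powr (1 / p)"
proof -
  have "s i = (s i powr p) powr (1 / p)" using assms by (simp add: powr_powr)
  also have "\<dots> \<le> (\<Sum>i\<in>I. s i powr p) powr (1 / p)"
    using assms member_le_sum[of i I "\<lambda>i. s i powr p"] by (intro powr_mono2) auto
  finally show ?thesis .
qed

text \<open>If \<open>\<sigma>\<close> is the \<open>\<ell>\<^sup>p\<close> norm, every entry is at most \<open>\<sigma>\<close>, so
  \<open>s\<^sub>i\<^sup>q = s\<^sub>i\<^sup>p s\<^sub>i\<^sup>q\<^sup>-\<^sup>p \<le> s\<^sub>i\<^sup>p \<sigma>\<^sup>q\<^sup>-\<^sup>p\<close>; sum over \<open>i\<close>.\<close>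
lemma powr_sum_antimono:
  fixes s :: "'i \<Rightarrow> real"
  assumes "1 \<le> p" "p \<le> q" "finite I" "\<And>i. i \<in> I \<Longrightarrow> 0 \<le> s i"
  shows "(\<Sum>i\<in>I. s i powr q) powr (1 / q) \<le> (\<Sum>i\<in>I. s i powr p) powr (1 / p)"
proof -
  define \<sigma> where "\<sigma> = (\<Sum>i\<in>I. s i powr p) powr (1 / p)"
  have \<sigma>0: "0 \<le> \<sigma>" by (simp add: \<sigma>_def)
  have \<sigma>p: "\<sigma> powr p = (\<Sum>i\<in>I. s i powr p)"
    using assms by (simp add: \<sigma>_def powr_powr sum_nonneg)
  have le: "s i \<le> \<sigma>" if "i \<in> I" for i
    using le_powr_sum[of p I i s] that assms by (simp add: \<sigma>_def)
  have split: "x powr q = x powr p * x powr (q - p)" for x :: real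
    by (simp add: powr_add[symmetric])
  have "(\<Sum>i\<in>I. s i powr q) \<le> (\<Sum>i\<in>I. s i powr p * \<sigma> powr (q - p))"
    unfolding split using assms le by (intro sum_mono mult_left_mono powr_mono2) auto
  also have "\<dots> = \<sigma> powr q"
    unfolding split[of \<sigma>] \<sigma>p by (simp add: sum_distrib_right)
  finally have "(\<Sum>i\<in>I. s i powr q) powr (1 / q) \<le> (\<sigma> powr q) powr (1 / q)"
    using assms by (intro powr_mono2) (auto intro: sum_nonneg)
  also have "\<dots> = \<sigma>" using \<sigma>0 assms by (simp add: powr_powr)
  finally show ?thesis by (simp add: \<sigma>_def)
qed

section \<open>The variational formula for finite exponents\<close>

text \<open>By the singular value decomposition, \<open>Y A X = P diag(s) R\<close> with contractions \<open>P\<close> and \<open>R\<close>.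
  The diagonal entries are bounded by \<open>\<Sum>\<^sub>k w\<^sub>i\<^sub>k s\<^sub>k\<close> with \<open>w\<^sub>i\<^sub>k = (\<bar>P\<^sub>i\<^sub>k\<bar>\<^sup>2 + \<bar>R\<^sub>k\<^sub>i\<bar>\<^sup>2) / 2\<close>, which is
  doubly substochastic: its row sums allow Jensen's inequality, and its column sums then bound the
  result by \<open>\<Sum>\<^sub>k s\<^sub>k\<^sup>p\<close>.\<close>
lemma schatten_norm_compression_le:
  fixes p :: real
  assumes p: "1 \<le> p" and A: "A \<in> carrier_mat m n"
    and X: "X \<in> carrier_mat n l" "contraction X" and Y: "Y \<in> carrier_mat l m" "contraction Y"
  shows "(\<Sum>i<l. cmod ((Y * A * X) $$ (i, i)) powr p) powr (1 / p) \<le> schatten_norm (ereal p) A"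
proof -
  obtain F Q s where F: "F \<in> carrier_mat m n" and Q: "Q \<in> unitary_mats n" and cF: "contraction F"
    and s: "\<And>i. i < n \<Longrightarrow> 0 \<le> s i"
    and AF: "A = F * mat_diag n (\<lambda>i. complex_of_real (s i)) * Q"
    and norm: "\<And>p. schatten_norm (ereal p) A = (\<Sum>i<n. s i powr p) powr (1 / p)"
    using singular_value_decomposition[OF A] by metis
  note Qc = unitary_matsD(1)[OF Q]
  let ?S = "mat_diag n (\<lambda>i. complex_of_real (s i))"
  define P where "P = Y * F"
  define R where "R = Q * X"
  have P: "P \<in> carrier_mat l n" "contraction P"
    using contraction_mult[OF Y(2) cF Y(1) F] Y F by (auto simp: P_def)
  have R: "R \<in> carrier_mat n l" "contraction R"
    using contraction_mult[OF contraction_unitary[OF Q] X(2) Qc X(1)] Qc X by (auto simp: R_def)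
  have "Y * A * X = (Y * F) * ?S * (Q * X)"
    unfolding AF using Y(1) F Qc X(1)
    by (simp add: assoc_mult_mat[of _ l m _ n _ n] assoc_mult_mat[of _ l m _ n _ l]
      assoc_mult_mat[of _ l n _ n _ l] assoc_mult_mat[of _ l n _ n _ n] assoc_mult_mat[of _ m n _ n _ l]
      assoc_mult_mat[of _ m n _ n _ n] assoc_mult_mat[of _ n n _ n _ l]
      mult_carrier_mat[of _ n n _ l] mult_carrier_mat[of _ n n _ n] mult_carrier_mat[of _ m n _ n]
      mult_carrier_mat[of _ m n _ l])
  then have YAX: "Y * A * X = P * ?S * R" by (simp add: P_def R_def)
  define w where "w i k = ((cmod (P $$ (i, k)))\<^sup>2 + (cmod (R $$ (k, i)))\<^sup>2) / 2" for i k
  have w0: "0 \<le> w i k" for i k by (simp add: w_def)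
  have w_row: "(\<Sum>k<n. w i k) \<le> 1" if "i < l" for i
    using contraction_row_sum[OF P(2,1) that] contraction_col_sum[OF R(2,1) that]
    by (simp add: w_def sum.distrib sum_divide_distrib[symmetric])
  have w_col: "(\<Sum>i<l. w i k) \<le> 1" if "k < n" for k
    using contraction_col_sum[OF P(2,1) that] contraction_row_sum[OF R(2,1) that]
    by (simp add: w_def sum.distrib sum_divide_distrib[symmetric])
  have entry: "cmod ((Y * A * X) $$ (i, i)) \<le> (\<Sum>k<n. w i k * s k)" if i: "i < l" for i
  proof -
    have "(Y * A * X) $$ (i, i) = (\<Sum>k<n. P $$ (i, k) * complex_of_real (s k) * R $$ (k, i))"
      unfolding YAX mat_diag_mult_right[OF P(1)] using P R i by (simp add: scalar_prod_def atLeast0LessThan)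
    also have "cmod \<dots> \<le> (\<Sum>k<n. w i k * s k)"
    proof (rule order.trans[OF norm_sum sum_mono])
      fix k assume "k \<in> {..<n}"
      then have "0 \<le> s k" using s by simp
      have "cmod (P $$ (i, k)) * cmod (R $$ (k, i)) \<le> w i k"
        using sum_squares_bound[of "cmod (P $$ (i, k))" "cmod (R $$ (k, i))"] by (simp add: w_def)
      from mult_right_mono[OF this \<open>0 \<le> s k\<close>]
      show "cmod (P $$ (i, k) * complex_of_real (s k) * R $$ (k, i)) \<le> w i k * s k"
        using \<open>0 \<le> s k\<close> by (simp add: norm_mult mult_ac)
    qed
    finally show ?thesis .
  qed
  have "(\<Sum>i<l. cmod ((Y * A * X) $$ (i, i)) powr p) \<le> (\<Sum>i<l. (\<Sum>k<n. w i k * s k) powr p)"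
    using entry p by (intro sum_mono powr_mono2) auto
  also have "\<dots> \<le> (\<Sum>i<l. \<Sum>k<n. w i k * s k powr p)"
    using w0 w_row s by (intro sum_mono powr_Jensen_subprob[OF p]) auto
  also have "\<dots> = (\<Sum>k<n. \<Sum>i<l. w i k * s k powr p)" by (rule sum.swap)
  also have "\<dots> = (\<Sum>k<n. (\<Sum>i<l. w i k) * s k powr p)" by (simp add: sum_distrib_right)
  also have "\<dots> \<le> (\<Sum>k<n. 1 * s k powr p)"
    using w_col by (intro sum_mono mult_right_mono) auto
  finally show ?thesis
    unfolding norm using p by (intro powr_mono2) (auto intro: sum_nonneg)
qed

text \<open>The factors of a singular value decomposition compress \<open>A\<close> to the diagonal matrix of its
  singular values, whatever the exponent.\<close>
lemma schatten_norm_compression_attained: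
  assumes A: "A \<in> carrier_mat m n"
  obtains X Y where "X \<in> carrier_mat n n" "contraction X" "Y \<in> carrier_mat n m" "contraction Y"
    "\<And>p. schatten_norm (ereal p) A = (\<Sum>i<n. cmod ((Y * A * X) $$ (i, i)) powr p) powr (1 / p)"
proof -
  obtain F Q s where F: "F \<in> carrier_mat m n" and Q: "Q \<in> unitary_mats n" and cF: "contraction F"
    and s: "\<And>i. i < n \<Longrightarrow> 0 \<le> s i"
    and diag: "mat_adjoint F * A * mat_adjoint Q = mat_diag n (\<lambda>i. complex_of_real (s i))"
    and norm: "\<And>p. schatten_norm (ereal p) A = (\<Sum>i<n. s i powr p) powr (1 / p)"
    using singular_value_decomposition[OF A] by metis
  have "cmod ((mat_adjoint F * A * mat_adjoint Q) $$ (i, i)) = s i" if "i < n" for i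
    using that s[OF that] unfolding diag by (simp add: mat_diag_def)
  then show ?thesis
    using F unitary_matsD(1)[OF Q]
    by (intro that[of "mat_adjoint Q" "mat_adjoint F"])
      (auto simp: norm intro: contraction_adjoint contraction_unitary[OF Q] cF)
qed

text \<open>Choose \<open>X\<close> and \<open>Y\<close> optimal for \<open>A + B\<close>. The diagonal of \<open>Y (A + B) X\<close> is additive in \<open>A\<close>
  and \<open>B\<close>, and \<open>X\<close> and \<open>Y\<close> are admissible for both.\<close>
lemma schatten_norm_finite_triangle:
  fixes p :: real
  assumes p: "1 \<le> p" and A: "A \<in> carrier_mat m n" and B: "B \<in> carrier_mat m n"
  shows "schatten_norm (ereal p) (A + B) \<le> schatten_norm (ereal p) A + schatten_norm (ereal p) B"
proof -
  have "A + B \<in> carrier_mat m n" using A B by simp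
  then obtain X Y where X: "X \<in> carrier_mat n n" "contraction X" and Y: "Y \<in> carrier_mat n m" "contraction Y"
    and norm: "\<And>p. schatten_norm (ereal p) (A + B) = (\<Sum>i<n. cmod ((Y * (A + B) * X) $$ (i, i)) powr p) powr (1 / p)"
    by (rule schatten_norm_compression_attained) blast
  have "Y * (A + B) * X = Y * A * X + Y * B * X"
    using X Y A B by (simp add: mult_add_distrib_mat[of Y n m] add_mult_distrib_mat[of _ n n])
  then have "cmod ((Y * (A + B) * X) $$ (i, i)) \<le> cmod ((Y * A * X) $$ (i, i)) + cmod ((Y * B * X) $$ (i, i))"
    if "i < n" for i
    using that X Y norm_triangle_ineq by simp
  then have "schatten_norm (ereal p) (A + B) \<le>
      (\<Sum>i<n. (cmod ((Y * A * X) $$ (i, i)) + cmod ((Y * B * X) $$ (i, i))) powr p) powr (1 / p)"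
    unfolding norm using p by (intro powr_mono2 sum_mono) (auto intro: sum_nonneg)
  also have "\<dots> \<le> (\<Sum>i<n. cmod ((Y * A * X) $$ (i, i)) powr p) powr (1 / p)
      + (\<Sum>i<n. cmod ((Y * B * X) $$ (i, i)) powr p) powr (1 / p)"
    using p by (intro powr_sum_Minkowski) auto
  also have "\<dots> \<le> schatten_norm (ereal p) A + schatten_norm (ereal p) B"
    using p A B X Y by (intro add_mono schatten_norm_compression_le)
  finally show ?thesis .
qed

text \<open>Contractions that are optimal for \<open>Y A X\<close> become admissible for \<open>A\<close> after multiplication by
  \<open>X\<close> and \<open>Y\<close>.\<close>
lemma schatten_norm_finite_ideal:
  fixes p :: real
  assumes p: "1 \<le> p" and A: "A \<in> carrier_mat m n"
    and X: "X \<in> carrier_mat n l" "contraction X" and Y: "Y \<in> carrier_mat k m" "contraction Y"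
  shows "schatten_norm (ereal p) (Y * A * X) \<le> schatten_norm (ereal p) A"
proof -
  have "Y * A * X \<in> carrier_mat k l" using A X Y by simp
  then obtain X' Y' where X': "X' \<in> carrier_mat l l" "contraction X'"
    and Y': "Y' \<in> carrier_mat l k" "contraction Y'"
    and norm: "\<And>p. schatten_norm (ereal p) (Y * A * X) = (\<Sum>i<l. cmod ((Y' * (Y * A * X) * X') $$ (i, i)) powr p) powr (1 / p)"
    by (rule schatten_norm_compression_attained) blast
  have eq: "Y' * (Y * A * X) * X' = (Y' * Y) * A * (X * X')"
  proof -
    have "Y' * (Y * A * X) = Y' * (Y * A) * X"
      using A X Y Y' by (intro assoc_mult_mat[symmetric, of _ l k _ n _ l]) auto
    also have "Y' * (Y * A) = Y' * Y * A"
      using A Y Y' by (intro assoc_mult_mat[symmetric, of _ l k _ m _ n]) auto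
    also have "Y' * Y * A * X * X' = Y' * Y * A * (X * X')"
      using A X Y X' Y' by (intro assoc_mult_mat[of _ l n _ l _ l]) auto
    finally show ?thesis .
  qed
  have "X * X' \<in> carrier_mat n l" "contraction (X * X')"
    using X X' contraction_mult[OF X(2) X'(2) X(1) X'(1)] by auto
  moreover have "Y' * Y \<in> carrier_mat l m" "contraction (Y' * Y)"
    using Y Y' contraction_mult[OF Y'(2) Y(2) Y'(1) Y(1)] by auto
  ultimately show ?thesis
    unfolding norm eq by (rule schatten_norm_compression_le[OF p A])
qed

section \<open>The Schatten norms for all exponents from one to infinity\<close>

text \<open>The operator norm is at most every Schatten norm, since every singular value is. At this point the
  bound also shows that the supremum in the definition of the operator norm is finite.\<close>
lemma mat_vec_le_schatten_norm:
  fixes p :: real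
  assumes p: "1 \<le> p" and A: "A \<in> carrier_mat m n" and v: "v \<in> carrier_vec n"
  shows "vec_l2_norm (A *\<^sub>v v) \<le> schatten_norm (ereal p) A * vec_l2_norm v"
proof -
  obtain F Q s where F: "F \<in> carrier_mat m n" and Q: "Q \<in> unitary_mats n" and cF: "contraction F"
    and s: "\<And>i. i < n \<Longrightarrow> 0 \<le> s i"
    and AF: "A = F * mat_diag n (\<lambda>i. complex_of_real (s i)) * Q"
    and norm: "\<And>p. schatten_norm (ereal p) A = (\<Sum>i<n. s i powr p) powr (1 / p)"
    using singular_value_decomposition[OF A] by metis
  note Qc = unitary_matsD(1)[OF Q]
  let ?S = "mat_diag n (\<lambda>i. complex_of_real (s i))" and ?\<sigma> = "schatten_norm (ereal p) A"
  define w where "w = Q *\<^sub>v v"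
  have w: "w \<in> carrier_vec n" using Qc v by (auto simp: w_def)
  have le: "s i \<le> ?\<sigma>" if "i < n" for i
    unfolding norm using p s that by (intro le_powr_sum) auto
  have \<sigma>: "0 \<le> ?\<sigma>" by (simp add: norm)
  have "A *\<^sub>v v = F *\<^sub>v (?S *\<^sub>v w)"
    unfolding AF w_def using F Qc v
    by (simp add: assoc_mult_mat_vec[of _ m n _ n] assoc_mult_mat_vec[of F m n ?S n])
  then have "vec_l2_norm (A *\<^sub>v v) \<le> vec_l2_norm (?S *\<^sub>v w)"
    using contractionD[OF cF F, of "?S *\<^sub>v w"] mult_mat_vec_carrier[OF mat_diag_dim w] by simp
  also have "?S *\<^sub>v w = vec n (\<lambda>i. complex_of_real (s i) * w $ i)"
    using w by (intro eq_vecI) (auto simp: mat_diag_def scalar_prod_def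
      if_distrib[of "\<lambda>x. x * _"] cong: if_cong)
  also have "vec_l2_norm \<dots> \<le> L2_set (\<lambda>i. ?\<sigma> * cmod (w $ i)) {..<n}"
    unfolding vec_l2_norm_def using s le
    by (auto simp: norm_mult intro!: L2_set_mono mult_right_mono)
  also have "\<dots> = ?\<sigma> * vec_l2_norm w"
    using \<sigma> w by (simp add: L2_set_right_distrib[symmetric] vec_l2_norm_def)
  also have "vec_l2_norm w \<le> vec_l2_norm v"
    unfolding w_def by (rule contractionD[OF contraction_unitary[OF Q] Qc v])
  finally show ?thesis using \<sigma> by (simp add: mult_left_mono)
qed

lemma mat_op_norm_upper:
  assumes A: "A \<in> carrier_mat m n" and v: "v \<in> carrier_vec n" "vec_l2_norm v \<le> 1"
  shows "vec_l2_norm (A *\<^sub>v v) \<le> mat_op_norm A"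
  unfolding mat_op_norm_def
proof (rule cSUP_upper)
  show "v \<in> {v \<in> carrier_vec (dim_col A). vec_l2_norm v \<le> 1}" using A v by auto
  show "bdd_above ((\<lambda>v. vec_l2_norm (A *\<^sub>v v)) ` {v \<in> carrier_vec (dim_col A). vec_l2_norm v \<le> 1})"
  proof (rule bdd_aboveI2)
    fix v assume "v \<in> {v \<in> carrier_vec (dim_col A). vec_l2_norm v \<le> 1}"
    then have v: "v \<in> carrier_vec n" "vec_l2_norm v \<le> 1" using A by auto
    have "0 \<le> schatten_norm (ereal 1) A" by (simp add: schatten_norm_def)
    then show "vec_l2_norm (A *\<^sub>v v) \<le> schatten_norm (ereal 1) A"
      using mat_vec_le_schatten_norm[of 1 A m n v] A v mult_left_le[of "vec_l2_norm v" "schatten_norm (ereal 1) A"]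
      by simp
  qed
qed

lemma mat_op_norm_least:
  assumes "A \<in> carrier_mat m n"
    and "\<And>v. v \<in> carrier_vec n \<Longrightarrow> vec_l2_norm v \<le> 1 \<Longrightarrow> vec_l2_norm (A *\<^sub>v v) \<le> c"
  shows "mat_op_norm A \<le> c"
  unfolding mat_op_norm_def
proof (rule cSUP_least)
  have "0\<^sub>v (dim_col A) \<in> {v \<in> carrier_vec (dim_col A). vec_l2_norm v \<le> 1}"
    by simp
  then show "{v \<in> carrier_vec (dim_col A). vec_l2_norm v \<le> 1} \<noteq> {}" by blast
qed (use assms in auto)

lemma mat_op_norm_nonneg:
  assumes A: "A \<in> carrier_mat m n"
  shows "0 \<le> mat_op_norm A"
proof -
  have "vec_l2_norm (A *\<^sub>v 0\<^sub>v n) \<le> mat_op_norm A"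
    by (intro mat_op_norm_upper[OF A]) auto
  then show ?thesis using vec_l2_norm_nonneg order.trans by blast
qed

lemma mat_vec_le_op_norm:
  assumes A: "A \<in> carrier_mat m n" and v: "v \<in> carrier_vec n"
  shows "vec_l2_norm (A *\<^sub>v v) \<le> mat_op_norm A * vec_l2_norm v"
proof (cases "vec_l2_norm v = 0")
  case True
  then have "A *\<^sub>v v = 0\<^sub>v m" using A v vec_l2_norm_eq_0_iff[OF v] by (intro eq_vecI) auto
  then show ?thesis using True by simp
next
  case False
  then have pos: "0 < vec_l2_norm v" by (simp add: less_le)
  let ?c = "complex_of_real (1 / vec_l2_norm v)"
  have "vec_l2_norm (A *\<^sub>v (?c \<cdot>\<^sub>v v)) \<le> mat_op_norm A"
    using A v pos by (intro mat_op_norm_upper) (auto simp: vec_l2_norm_smult norm_divide)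
  then show ?thesis
    using pos mult_mat_vec[OF A v] by (simp add: vec_l2_norm_smult norm_divide field_simps)
qed

lemma ereal_ge_1_cases:
  assumes "1 \<le> (p :: ereal)"
  obtains (infinite) "p = \<infinity>" | (finite) r where "p = ereal r" "1 \<le> r"
  using assms by (cases p) auto

lemma schatten_norm_infinity: "schatten_norm \<infinity> A = mat_op_norm A"
  by (simp add: schatten_norm_def)

lemma schatten_norm_nonneg:
  assumes "A \<in> carrier_mat m n"
  shows "0 \<le> schatten_norm p A"
  using mat_op_norm_nonneg[OF assms] by (simp add: schatten_norm_def)

lemma schatten_norm_triangle:
  assumes "1 \<le> p" and A: "A \<in> carrier_mat m n" and B: "B \<in> carrier_mat m n"
  shows "schatten_norm p (A + B) \<le> schatten_norm p A + schatten_norm p B"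
  using assms(1)
proof (cases p rule: ereal_ge_1_cases)
  case infinite
  have "A + B \<in> carrier_mat m n" using A B by simp
  then have "mat_op_norm (A + B) \<le> mat_op_norm A + mat_op_norm B"
  proof (rule mat_op_norm_least)
    fix v :: "complex vec" assume v: "v \<in> carrier_vec n" "vec_l2_norm v \<le> 1"
    have "vec_l2_norm ((A + B) *\<^sub>v v) \<le> vec_l2_norm (A *\<^sub>v v) + vec_l2_norm (B *\<^sub>v v)"
      using A B v by (simp add: add_mult_distrib_mat_vec[of _ m n] vec_l2_norm_triangle[of _ m])
    also have "\<dots> \<le> mat_op_norm A + mat_op_norm B"
      using A B v by (intro add_mono mat_op_norm_upper)
    finally show "vec_l2_norm ((A + B) *\<^sub>v v) \<le> mat_op_norm A + mat_op_norm B" .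
  qed
  then show ?thesis by (simp add: infinite schatten_norm_infinity)
next
  case (finite r)
  then show ?thesis using schatten_norm_finite_triangle[OF finite(2) A B] by simp
qed

lemma schatten_norm_ideal:
  assumes "1 \<le> p" and A: "A \<in> carrier_mat m n"
    and X: "X \<in> carrier_mat n l" "contraction X" and Y: "Y \<in> carrier_mat k m" "contraction Y"
  shows "schatten_norm p (Y * A * X) \<le> schatten_norm p A"
  using assms(1)
proof (cases p rule: ereal_ge_1_cases)
  case infinite
  have "Y * A * X \<in> carrier_mat k l" using A X Y by simp
  then have "mat_op_norm (Y * A * X) \<le> mat_op_norm A"
  proof (rule mat_op_norm_least)
    fix v :: "complex vec" assume v: "v \<in> carrier_vec l" "vec_l2_norm v \<le> 1"
    have Xv: "X *\<^sub>v v \<in> carrier_vec n" using X v by simp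
    have "(Y * A * X) *\<^sub>v v = (Y * A) *\<^sub>v (X *\<^sub>v v)"
      using A X(1) Y(1) v by (intro assoc_mult_mat_vec[of _ k n _ l]) auto
    also have "\<dots> = Y *\<^sub>v (A *\<^sub>v (X *\<^sub>v v))"
      using A Y(1) Xv by (intro assoc_mult_mat_vec[of Y k m A n]) auto
    finally have "(Y * A * X) *\<^sub>v v = Y *\<^sub>v (A *\<^sub>v (X *\<^sub>v v))" .
    then have "vec_l2_norm ((Y * A * X) *\<^sub>v v) \<le> vec_l2_norm (A *\<^sub>v (X *\<^sub>v v))"
      using contractionD[OF Y(2,1)] mult_mat_vec_carrier[OF A Xv] by simp
    also have "\<dots> \<le> mat_op_norm A"
      using contractionD[OF X(2,1) v(1)] v(2) by (intro mat_op_norm_upper[OF A Xv]) simp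
    finally show "vec_l2_norm ((Y * A * X) *\<^sub>v v) \<le> mat_op_norm A" .
  qed
  then show ?thesis by (simp add: infinite schatten_norm_infinity)
next
  case (finite r)
  then show ?thesis using schatten_norm_finite_ideal[OF finite(2) A X Y] by simp
qed

lemma schatten_norm_antimono:
  assumes "1 \<le> p" "p \<le> q" and A: "A \<in> carrier_mat m n"
  shows "schatten_norm q A \<le> schatten_norm p A"
  using assms(1)
proof (cases p rule: ereal_ge_1_cases)
  case infinite
  then show ?thesis using assms by simp
next
  case (finite r)
  have "1 \<le> q" using assms by simp
  then show ?thesis
  proof (cases q rule: ereal_ge_1_cases)
    case infinite
    have "mat_op_norm A \<le> schatten_norm p A"
    proof (rule mat_op_norm_least[OF A])
      fix v :: "complex vec" assume v: "v \<in> carrier_vec n" "vec_l2_norm v \<le> 1"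
      then show "vec_l2_norm (A *\<^sub>v v) \<le> schatten_norm p A"
        using mat_vec_le_schatten_norm[OF finite(2) A v(1)] schatten_norm_nonneg[OF A, of p]
          mult_left_le[of "vec_l2_norm v" "schatten_norm p A"]
        by (simp add: finite(1))
    qed
    then show ?thesis by (simp add: infinite schatten_norm_infinity)
  next
    case (finite t)
    obtain s where "\<And>i. i < n \<Longrightarrow> 0 \<le> s i"
      and "\<And>p. schatten_norm (ereal p) A = (\<Sum>i<n. s i powr p) powr (1 / p)"
      using singular_value_decomposition[OF A] by metis
    then show ?thesis
      using powr_sum_antimono[of r t "{..<n}" s] \<open>p = ereal r\<close> \<open>1 \<le> r\<close> \<open>p \<le> q\<close> finite by simp
  qed
qed

lemma schatten_norm_mult_left:
  assumes "1 \<le> p" "A \<in> carrier_mat m n" "Y \<in> carrier_mat k m" "contraction Y"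
  shows "schatten_norm p (Y * A) \<le> schatten_norm p A"
  using schatten_norm_ideal[OF assms(1,2) one_carrier_mat contraction_unitary[OF unitary_one] assms(3,4)]
    assms(2,3) by simp

lemma schatten_norm_mult_right:
  assumes "1 \<le> p" "A \<in> carrier_mat m n" "X \<in> carrier_mat n l" "contraction X"
  shows "schatten_norm p (A * X) \<le> schatten_norm p A"
  using schatten_norm_ideal[OF assms one_carrier_mat contraction_unitary[OF unitary_one]] assms(2)
  by simp

lemma schatten_norm_diff_triangle:
  assumes "1 \<le> p" "A \<in> carrier_mat m n" "B \<in> carrier_mat m n" "C \<in> carrier_mat m n"
  shows "schatten_norm p (A - C) \<le> schatten_norm p (A - B) + schatten_norm p (B - C)"
proof -
  have "A - C = (A - B) + (B - C)" using assms by (intro eq_matI) auto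
  then show ?thesis
    using schatten_norm_triangle[OF assms(1) minus_carrier_mat[OF assms(3)] minus_carrier_mat[OF assms(4)], of A B]
    by simp
qed

lemma schatten_norm_diff_commute:
  assumes "1 \<le> p" "A \<in> carrier_mat m n" "B \<in> carrier_mat m n"
  shows "schatten_norm p (A - B) = schatten_norm p (B - A)"
proof -
  have "schatten_norm p (A - B) \<le> schatten_norm p (B - A)"
    if "A \<in> carrier_mat m n" "B \<in> carrier_mat m n" for A B
  proof -
    have "contraction (- 1\<^sub>m m)"
    proof (rule contraction_isometry[of _ m m])
      show "mat_adjoint (- 1\<^sub>m m) * - 1\<^sub>m m = (1\<^sub>m m :: complex mat)"
      proof -
        have "mat_adjoint (- 1\<^sub>m m) = (- 1\<^sub>m m :: complex mat)" by (intro eq_matI) auto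
        then show ?thesis by simp
      qed
    qed simp
    moreover have "A - B = (- 1\<^sub>m m) * (B - A)"
    proof -
      have "(- 1\<^sub>m m) * (B - A) = - (1\<^sub>m m * (B - A))"
        using that by (simp add: uminus_mult_left_mat)
      also have "1\<^sub>m m * (B - A) = B - A" using that by (intro left_mult_one_mat[of _ m n]) auto
      also have "- (B - A) = A - B" using that by (intro eq_matI) auto
      finally show ?thesis by simp
    qed
    ultimately show ?thesis
      using schatten_norm_mult_left[OF assms(1) minus_carrier_mat[OF that(1)], of "- 1\<^sub>m m" m B] by simp
  qed
  then show ?thesis using assms by (intro antisym) auto
qed

section \<open>Direct sums and the Schatten norms\<close>

lemma mat_dsum_empty [simp]:
  "mat_dsum A (0\<^sub>m 0 0) = A" "mat_dsum (0\<^sub>m 0 0) A = A"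
  by (intro eq_matI; simp add: mat_dsum_def)+

text \<open>The inclusions of the two summands are \<open>1 \<oplus> 0\<close> and \<open>0 \<oplus> 1\<close> with a zero block that has no
  columns. With this choice all products are block products of direct sums, and
  \<open>mat_dsum_empty\<close> removes the empty blocks.\<close>
lemma mat_dsum_inclusions:
  fixes m k :: nat
  defines "J \<equiv> mat_dsum (1\<^sub>m m) (0\<^sub>m k 0) :: complex mat"
    and "K \<equiv> mat_dsum (0\<^sub>m m 0) (1\<^sub>m k) :: complex mat"
  shows "J \<in> carrier_mat (m + k) m" "K \<in> carrier_mat (m + k) k" "contraction J" "contraction K"
    and "A \<in> carrier_mat m m \<Longrightarrow> B \<in> carrier_mat k k \<Longrightarrow> mat_adjoint J * mat_dsum A B * J = A"
    and "A \<in> carrier_mat m m \<Longrightarrow> B \<in> carrier_mat k k \<Longrightarrow> mat_adjoint K * mat_dsum A B * K = B"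
    and "A \<in> carrier_mat m m \<Longrightarrow> J * A * mat_adjoint J = mat_dsum A (0\<^sub>m k k)"
    and "B \<in> carrier_mat k k \<Longrightarrow> K * B * mat_adjoint K = mat_dsum (0\<^sub>m m m) B"
proof -
  show J: "J \<in> carrier_mat (m + k) m"
    using mat_dsum_carrier[of "1\<^sub>m m" m m "0\<^sub>m k 0" k 0] by (simp add: J_def)
  show K: "K \<in> carrier_mat (m + k) k"
    using mat_dsum_carrier[of "0\<^sub>m m 0" m 0 "1\<^sub>m k" k k] by (simp add: K_def)
  have J': "mat_adjoint J = mat_dsum (1\<^sub>m m) (0\<^sub>m 0 k)" by (simp add: J_def mat_dsum_adjoint)
  have K': "mat_adjoint K = mat_dsum (0\<^sub>m 0 m) (1\<^sub>m k)" by (simp add: K_def mat_dsum_adjoint)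
  have J'J: "mat_adjoint J * J = 1\<^sub>m m"
    unfolding J' unfolding J_def by (simp add: mat_dsum_mult[of _ m m _ m _ 0 k _ 0])
  show "contraction J" using J J'J by (rule contraction_isometry)
  have K'K: "mat_adjoint K * K = 1\<^sub>m k"
    unfolding K' unfolding K_def by (simp add: mat_dsum_mult[of _ 0 m _ 0 _ k k _ k])
  show "contraction K" using K K'K by (rule contraction_isometry)
  show "mat_adjoint J * mat_dsum A B * J = A" if "A \<in> carrier_mat m m" "B \<in> carrier_mat k k"
    unfolding J' unfolding J_def using that
    by (simp add: mat_dsum_mult[of _ m m _ m _ 0 k _ k] mat_dsum_mult[of _ m m _ m _ 0 k _ 0])
  show "mat_adjoint K * mat_dsum A B * K = B" if "A \<in> carrier_mat m m" "B \<in> carrier_mat k k"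
    unfolding K' unfolding K_def using that
    by (simp add: mat_dsum_mult[of _ 0 m _ m _ k k _ k] mat_dsum_mult[of _ 0 m _ 0 _ k k _ k])
  show "J * A * mat_adjoint J = mat_dsum A (0\<^sub>m k k)" if A: "A \<in> carrier_mat m m"
  proof -
    have "J * mat_dsum A (0\<^sub>m 0 0) * mat_adjoint J = mat_dsum A (0\<^sub>m k k)"
      unfolding J' unfolding J_def using A
      by (simp add: mat_dsum_mult[of _ m m _ m _ k 0 _ 0] mat_dsum_mult[of _ m m _ m _ k 0 _ k] del: mat_dsum_empty)
    then show ?thesis by simp
  qed
  show "K * B * mat_adjoint K = mat_dsum (0\<^sub>m m m) B" if B: "B \<in> carrier_mat k k"
  proof -
    have "K * mat_dsum (0\<^sub>m 0 0) B * mat_adjoint K = mat_dsum (0\<^sub>m m m) B"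
      unfolding K' unfolding K_def using B
      by (simp add: mat_dsum_mult[of _ m 0 _ 0 _ k k _ k] mat_dsum_mult[of _ m 0 _ m _ k k _ k] del: mat_dsum_empty)
    then show ?thesis by simp
  qed
qed

text \<open>Compressing \<open>A \<oplus> B\<close> with the inclusions gives its summands; conversely \<open>A \<oplus> B\<close> is the sum of
  \<open>A \<oplus> 0\<close> and \<open>0 \<oplus> B\<close>, to which the inclusions dilate \<open>A\<close> and \<open>B\<close>.\<close>
lemma schatten_norm_dsum:
  assumes p: "1 \<le> p" and A: "A \<in> carrier_mat m m" and B: "B \<in> carrier_mat k k"
  shows "schatten_norm p A \<le> schatten_norm p (mat_dsum A B)"
    and "schatten_norm p B \<le> schatten_norm p (mat_dsum A B)"
    and "schatten_norm p (mat_dsum A B) \<le> schatten_norm p A + schatten_norm p B"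
proof -
  define J where "J = (mat_dsum (1\<^sub>m m) (0\<^sub>m k 0) :: complex mat)"
  define K where "K = (mat_dsum (0\<^sub>m m 0) (1\<^sub>m k) :: complex mat)"
  note JK = mat_dsum_inclusions[where m = m and k = k, folded J_def K_def]
  note adj = mat_adjoint_carrier[OF JK(1)] contraction_adjoint[OF JK(3)]
    mat_adjoint_carrier[OF JK(2)] contraction_adjoint[OF JK(4)]
  have AB: "mat_dsum A B \<in> carrier_mat (m + k) (m + k)" by (rule mat_dsum_carrier[OF A B])
  show "schatten_norm p A \<le> schatten_norm p (mat_dsum A B)"
    using schatten_norm_ideal[OF p AB JK(1,3) adj(1,2)] JK(5)[OF A B] by simp
  show "schatten_norm p B \<le> schatten_norm p (mat_dsum A B)"
    using schatten_norm_ideal[OF p AB JK(2,4) adj(3,4)] JK(6)[OF A B] by simp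
  have "mat_dsum A B = mat_dsum A (0\<^sub>m k k) + mat_dsum (0\<^sub>m m m) B"
    using A B unfolding mat_dsum_def by (intro eq_matI) auto
  then have "schatten_norm p (mat_dsum A B) \<le>
      schatten_norm p (mat_dsum A (0\<^sub>m k k)) + schatten_norm p (mat_dsum (0\<^sub>m m m) B)"
    using A B schatten_norm_triangle[OF p mat_dsum_carrier mat_dsum_carrier, of A m m "0\<^sub>m k k" k k "0\<^sub>m m m" B]
    by simp
  also have "\<dots> \<le> schatten_norm p A + schatten_norm p B"
    using schatten_norm_ideal[OF p A adj(1,2) JK(1,3)] schatten_norm_ideal[OF p B adj(3,4) JK(2,4)]
    unfolding JK(7)[OF A] JK(8)[OF B] by (rule add_mono)
  finally show "schatten_norm p (mat_dsum A B) \<le> schatten_norm p A + schatten_norm p B" .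
qed

section \<open>Unitary matrices with a power close to the identity\<close>

lemma unitary_pow:
  assumes "U \<in> unitary_mats n"
  shows "U ^\<^sub>m k \<in> unitary_mats n"
proof (induction k)
  case 0
  then show ?case using unitary_one unitary_matsD(1)[OF assms] by simp
qed (simp add: unitary_mult assms)

lemma contraction_inverse:
  assumes T: "T \<in> carrier_mat n n"
    and expand: "\<And>v. v \<in> carrier_vec n \<Longrightarrow> vec_l2_norm v \<le> vec_l2_norm (T *\<^sub>v v)"
  obtains S where "S \<in> carrier_mat n n" "contraction S" "S * T = 1\<^sub>m n"
proof -
  have "det T \<noteq> 0"
  proof
    assume "det T = 0"
    then obtain v where v: "v \<in> carrier_vec n" "v \<noteq> 0\<^sub>v n" "T *\<^sub>v v = 0\<^sub>v n"
      using det_0_iff_vec_prod_zero[OF T] by blast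
    then have "vec_l2_norm v = 0" using expand[OF v(1)] by (simp add: order.antisym)
    then show False using v vec_l2_norm_eq_0_iff by blast
  qed
  then obtain S where S: "S \<in> carrier_mat n n" "S * T = 1\<^sub>m n" "T * S = 1\<^sub>m n"
    using det_non_zero_imp_unit[OF T, of "()"] by (auto simp: Units_def ring_mat_def)
  moreover have "contraction S"
    unfolding contraction_def
  proof
    fix v :: "complex vec" assume "v \<in> carrier_vec (dim_col S)"
    then have v: "v \<in> carrier_vec n" using S by auto
    have "T *\<^sub>v (S *\<^sub>v v) = v"
      using assoc_mult_mat_vec[OF T S(1) v] S(3) v by simp
    then show "vec_l2_norm (S *\<^sub>v v) \<le> vec_l2_norm v"
      using expand[of "S *\<^sub>v v"] mult_mat_vec_carrier[OF S(1) v] by simp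
  qed
  ultimately show ?thesis using that by blast
qed

text \<open>The matrix \<open>T\<close> is \<open>1 + U + \<dots> + U\<^sup>k\<^sup>-\<^sup>1\<close>. As \<open>U\<^sup>j\<close> moves \<open>v\<close> by at most \<open>j\<close> times
  the bound for \<open>U\<close>, \<open>T v\<close> differs from \<open>k v\<close> by at most \<open>0 + 1 + \<dots> + (k - 1)\<close> times that bound.\<close>
lemma unitary_geometric_sum:
  assumes U: "U \<in> unitary_mats n"
    and c: "\<And>v. v \<in> carrier_vec n \<Longrightarrow> vec_l2_norm (U *\<^sub>v v - v) \<le> c * vec_l2_norm v"
  shows "\<exists>T\<in>carrier_mat n n. T * (U - 1\<^sub>m n) = U ^\<^sub>m k - 1\<^sub>m n \<and>
    (\<forall>v\<in>carrier_vec n. vec_l2_norm (T *\<^sub>v v - of_nat k \<cdot>\<^sub>v v) \<le> c * (real k * (real k - 1) / 2) * vec_l2_norm v)"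
proof (induction k)
  case 0
  note Uc = unitary_matsD[OF U]
  have zero: "0\<^sub>m n n * (U - 1\<^sub>m n) = U ^\<^sub>m 0 - 1\<^sub>m n"
    using Uc(1) by (intro eq_matI) (auto simp: left_mult_zero_mat[of _ n n])
  have "vec_l2_norm (0\<^sub>m n n *\<^sub>v v - of_nat 0 \<cdot>\<^sub>v v) \<le> c * (real 0 * (real 0 - 1) / 2) * vec_l2_norm v"
    if "v \<in> carrier_vec n" for v
  proof -
    have "0\<^sub>m n n *\<^sub>v v - of_nat 0 \<cdot>\<^sub>v v = 0\<^sub>v n" using that by (intro eq_vecI) auto
    then show ?thesis by simp
  qed
  then show ?case by (intro bexI[of _ "0\<^sub>m n n"] conjI ballI zero zero_carrier_mat)
next
  case (Suc k)
  note Uc = unitary_matsD[OF U] and Uk = unitary_pow[OF U, of k]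
  note Ukc = unitary_matsD(1)[OF Uk]
  obtain T where T: "T \<in> carrier_mat n n" "T * (U - 1\<^sub>m n) = U ^\<^sub>m k - 1\<^sub>m n"
    and Tv: "\<And>v. v \<in> carrier_vec n \<Longrightarrow>
      vec_l2_norm (T *\<^sub>v v - of_nat k \<cdot>\<^sub>v v) \<le> c * (real k * (real k - 1) / 2) * vec_l2_norm v"
    using Suc by blast
  have pow: "vec_l2_norm ((U ^\<^sub>m j) *\<^sub>v v - v) \<le> c * real j * vec_l2_norm v" if v: "v \<in> carrier_vec n" for j v
  proof (induction j)
    case 0
    have "1\<^sub>m n *\<^sub>v v - v = 0\<^sub>v n" using v by (intro eq_vecI) auto
    then show ?case using Uc(1) by simp
  next
    case (Suc j)
    note Uj = unitary_pow[OF U, of j]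
    note Ujc = unitary_matsD(1)[OF Uj]
    have Uv: "U *\<^sub>v v \<in> carrier_vec n" using Uc(1) v by simp
    have "(U ^\<^sub>m Suc j) *\<^sub>v v = (U ^\<^sub>m j) *\<^sub>v (U *\<^sub>v v)"
      using assoc_mult_mat_vec[OF Ujc Uc(1) v] by simp
    moreover have "(U ^\<^sub>m j) *\<^sub>v (U *\<^sub>v v - v) = (U ^\<^sub>m j) *\<^sub>v (U *\<^sub>v v) - (U ^\<^sub>m j) *\<^sub>v v"
      by (rule mult_minus_distrib_mat_vec[OF Ujc Uv v])
    ultimately have "(U ^\<^sub>m Suc j) *\<^sub>v v - v = (U ^\<^sub>m j) *\<^sub>v (U *\<^sub>v v - v) + ((U ^\<^sub>m j) *\<^sub>v v - v)"
      using Ujc v by (intro eq_vecI) auto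
    then have "vec_l2_norm ((U ^\<^sub>m Suc j) *\<^sub>v v - v) \<le>
        vec_l2_norm ((U ^\<^sub>m j) *\<^sub>v (U *\<^sub>v v - v)) + vec_l2_norm ((U ^\<^sub>m j) *\<^sub>v v - v)"
      using Ujc Uv v by (simp add: vec_l2_norm_triangle[of _ n])
    also have "vec_l2_norm ((U ^\<^sub>m j) *\<^sub>v (U *\<^sub>v v - v)) \<le> vec_l2_norm (U *\<^sub>v v - v)"
      using Uv v by (intro contractionD[OF contraction_unitary[OF Uj] Ujc]) auto
    finally show ?case using c[OF v] Suc.IH by (simp add: algebra_simps)
  qed
  let ?T = "T + U ^\<^sub>m k"
  have "?T * (U - 1\<^sub>m n) = T * (U - 1\<^sub>m n) + U ^\<^sub>m k * (U - 1\<^sub>m n)"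
    using T Ukc Uc(1) by (intro add_mult_distrib_mat[of _ n n]) auto
  also have "U ^\<^sub>m k * (U - 1\<^sub>m n) = U ^\<^sub>m k * U - U ^\<^sub>m k"
    using Ukc Uc(1) by (simp add: mult_minus_distrib_mat[of _ n n])
  also have "T * (U - 1\<^sub>m n) + (U ^\<^sub>m k * U - U ^\<^sub>m k) = U ^\<^sub>m Suc k - 1\<^sub>m n"
    unfolding T(2) using Ukc Uc(1) by (intro eq_matI) auto
  finally have "?T * (U - 1\<^sub>m n) = U ^\<^sub>m Suc k - 1\<^sub>m n" .
  moreover have "vec_l2_norm (?T *\<^sub>v v - of_nat (Suc k) \<cdot>\<^sub>v v) \<le>
      c * (real (Suc k) * (real (Suc k) - 1) / 2) * vec_l2_norm v" if v: "v \<in> carrier_vec n" for v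
  proof -
    have "?T *\<^sub>v v - of_nat (Suc k) \<cdot>\<^sub>v v = (T *\<^sub>v v - of_nat k \<cdot>\<^sub>v v) + ((U ^\<^sub>m k) *\<^sub>v v - v)"
      using T(1) Ukc v by (intro eq_vecI) (auto simp: add_mult_distrib_mat_vec algebra_simps)
    then have "vec_l2_norm (?T *\<^sub>v v - of_nat (Suc k) \<cdot>\<^sub>v v) \<le>
        vec_l2_norm (T *\<^sub>v v - of_nat k \<cdot>\<^sub>v v) + vec_l2_norm ((U ^\<^sub>m k) *\<^sub>v v - v)"
      using T(1) Ukc v by (simp add: vec_l2_norm_triangle[of _ n])
    also have "\<dots> \<le> c * (real k * (real k - 1) / 2) * vec_l2_norm v + c * real k * vec_l2_norm v"
      by (intro add_mono Tv pow v)
    also have "\<dots> = c * (real (Suc k) * (real (Suc k) - 1) / 2) * vec_l2_norm v"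
      by (simp add: field_simps)
    finally show ?thesis .
  qed
  ultimately show ?case using T(1) Ukc by (intro bexI[of _ ?T]) auto
qed

text \<open>If \<open>U\<close> is within \<open>2 / m\<close> of the identity, then \<open>T = 1 + U + \<dots> + U\<^sup>m\<^sup>-\<^sup>1\<close> satisfies
  \<open>\<parallel>T v\<parallel> \<ge> m \<parallel>v\<parallel> - (m - 1) \<parallel>v\<parallel> = \<parallel>v\<parallel>\<close>, so its inverse is a contraction, and
  \<open>U - 1 = T\<^sup>-\<^sup>1 (U\<^sup>m - 1)\<close>.\<close>
lemma unitary_schatten_dist_le_power:
  assumes p: "1 \<le> p" and U: "U \<in> unitary_mats n" and m: "0 < m"
    and close: "mat_op_norm (U - 1\<^sub>m n) \<le> 2 / real m"
  shows "schatten_norm p (U - 1\<^sub>m n) \<le> schatten_norm p (U ^\<^sub>m m - 1\<^sub>m n)"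
proof -
  note Uc = unitary_matsD(1)[OF U]
  have D: "U - 1\<^sub>m n \<in> carrier_mat n n" by (rule minus_carrier_mat) simp
  have "vec_l2_norm (U *\<^sub>v v - v) \<le> 2 / real m * vec_l2_norm v" if v: "v \<in> carrier_vec n" for v
  proof -
    have "U *\<^sub>v v - v = (U - 1\<^sub>m n) *\<^sub>v v"
      using Uc v by (simp add: minus_mult_distrib_mat_vec[of _ n n])
    also have "vec_l2_norm \<dots> \<le> mat_op_norm (U - 1\<^sub>m n) * vec_l2_norm v"
      by (rule mat_vec_le_op_norm[OF D v])
    also have "\<dots> \<le> 2 / real m * vec_l2_norm v" using close by (intro mult_right_mono) auto
    finally show ?thesis .
  qed
  from unitary_geometric_sum[OF U this, of m] obtain T where T: "T \<in> carrier_mat n n"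
    and TU: "T * (U - 1\<^sub>m n) = U ^\<^sub>m m - 1\<^sub>m n"
    and Tv: "\<And>v. v \<in> carrier_vec n \<Longrightarrow> vec_l2_norm (T *\<^sub>v v - of_nat m \<cdot>\<^sub>v v)
      \<le> 2 / real m * (real m * (real m - 1) / 2) * vec_l2_norm v" by blast
  have "vec_l2_norm v \<le> vec_l2_norm (T *\<^sub>v v)" if v: "v \<in> carrier_vec n" for v
  proof -
    \<comment> \<open>The deviation of \<open>T v\<close> from \<open>m v\<close> is at most \<open>(2 / m) \<cdot> (m (m - 1) / 2) = m - 1\<close> times \<open>\<parallel>v\<parallel>\<close>.\<close>
    have "of_nat m \<cdot>\<^sub>v v = T *\<^sub>v v + (- 1) \<cdot>\<^sub>v (T *\<^sub>v v - of_nat m \<cdot>\<^sub>v v)"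
      using T v by (intro eq_vecI) auto
    then have "vec_l2_norm (of_nat m \<cdot>\<^sub>v v) \<le>
        vec_l2_norm (T *\<^sub>v v) + vec_l2_norm ((- 1) \<cdot>\<^sub>v (T *\<^sub>v v - of_nat m \<cdot>\<^sub>v v))"
      using T v by (metis minus_carrier_vec mult_mat_vec_carrier smult_carrier_vec vec_l2_norm_triangle)
    then have "real m * vec_l2_norm v \<le> vec_l2_norm (T *\<^sub>v v) + vec_l2_norm (T *\<^sub>v v - of_nat m \<cdot>\<^sub>v v)"
      by (simp add: vec_l2_norm_smult)
    also have "\<dots> \<le> vec_l2_norm (T *\<^sub>v v) + (real m - 1) * vec_l2_norm v"
    proof (rule add_left_mono)
      have "2 / real m * (real m * (real m - 1) / 2) = real m - 1" using m by simp
      from Tv[OF v, unfolded this]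
      show "vec_l2_norm (T *\<^sub>v v - of_nat m \<cdot>\<^sub>v v) \<le> (real m - 1) * vec_l2_norm v" .
    qed
    finally show ?thesis by (simp add: algebra_simps)
  qed
  then obtain S where S: "S \<in> carrier_mat n n" "contraction S" "S * T = 1\<^sub>m n"
    using contraction_inverse[OF T] by blast
  have "U - 1\<^sub>m n = S * (T * (U - 1\<^sub>m n))"
    using assoc_mult_mat[OF S(1) T D] S(3) Uc by simp
  also have "schatten_norm p \<dots> \<le> schatten_norm p (T * (U - 1\<^sub>m n))"
    by (rule schatten_norm_mult_left[OF p mult_carrier_mat[OF T D] S(1,2)])
  finally show ?thesis unfolding TU .
qed

section \<open>Asymptotic homomorphisms\<close>

lemma liminf_ereal_pos_iff:
  fixes f :: "nat \<Rightarrow> real"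
  shows "0 < liminf (\<lambda>n. ereal (f n)) \<longleftrightarrow> (\<exists>\<epsilon>>0. \<forall>\<^sub>F n in sequentially. \<epsilon> \<le> f n)"
proof
  assume "0 < liminf (\<lambda>n. ereal (f n))"
  then obtain \<epsilon> where \<epsilon>: "0 < ereal \<epsilon>" "ereal \<epsilon> < liminf (\<lambda>n. ereal (f n))"
    using ereal_dense2 by blast
  then have "\<forall>\<^sub>F n in sequentially. \<epsilon> \<le> f n"
    by (auto dest!: less_LiminfD elim!: eventually_mono)
  then show "\<exists>\<epsilon>>0. \<forall>\<^sub>F n in sequentially. \<epsilon> \<le> f n" using \<epsilon>(1) by auto
next
  assume "\<exists>\<epsilon>>0. \<forall>\<^sub>F n in sequentially. \<epsilon> \<le> f n"
  then obtain \<epsilon> where \<epsilon>: "0 < \<epsilon>" "\<forall>\<^sub>F n in sequentially. \<epsilon> \<le> f n" by blast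
  then have "ereal \<epsilon> \<le> liminf (\<lambda>n. ereal (f n))"
    by (intro Liminf_bounded) (auto elim!: eventually_mono)
  then show "0 < liminf (\<lambda>n. ereal (f n))" using \<epsilon>(1) by (simp add: less_le_trans[of 0 "ereal \<epsilon>"])
qed

locale asymptotic_hom = group G for G (structure) +
  fixes p :: ereal and \<phi> :: "nat \<Rightarrow> 'a \<Rightarrow> complex mat"
  assumes p_ge_1: "1 \<le> p"
    and unitary: "\<And>n g. g \<in> carrier G \<Longrightarrow> \<phi> n g \<in> unitary_mats n"
    and asymp_mult: "\<And>g h. g \<in> carrier G \<Longrightarrow> h \<in> carrier G \<Longrightarrow>
      (\<lambda>n. schatten_norm p (\<phi> n (g \<otimes> h) - \<phi> n g * \<phi> n h)) \<longlonglongrightarrow> 0"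
begin

lemma carrier_unitary: "g \<in> carrier G \<Longrightarrow> \<phi> n g \<in> carrier_mat n n"
  using unitary unitary_matsD(1) by blast

text \<open>Unitary invariance: \<open>\<parallel>1 - U\<parallel> = \<parallel>U - U U\<parallel>\<close> for \<open>U = \<phi>\<^sub>n(1)\<close>, and the right-hand side is a defect of
  multiplicativity.\<close>
lemma asymp_one: "(\<lambda>n. schatten_norm p (\<phi> n \<one> - 1\<^sub>m n)) \<longlonglongrightarrow> 0"
proof (rule tendsto_sandwich[OF _ _ tendsto_const asymp_mult[OF one_closed one_closed]])
  show "\<forall>\<^sub>F n in sequentially. 0 \<le> schatten_norm p (\<phi> n \<one> - 1\<^sub>m n)"
    by (intro always_eventually allI schatten_norm_nonneg[OF minus_carrier_mat[OF one_carrier_mat]])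
  show "\<forall>\<^sub>F n in sequentially. schatten_norm p (\<phi> n \<one> - 1\<^sub>m n)
      \<le> schatten_norm p (\<phi> n (\<one> \<otimes> \<one>) - \<phi> n \<one> * \<phi> n \<one>)"
  proof (intro always_eventually allI)
    fix n
    let ?U = "\<phi> n \<one>"
    have U: "?U \<in> unitary_mats n" using unitary by simp
    note Uc = unitary_matsD[OF U]
    have "mat_adjoint ?U * (?U - ?U * ?U) = mat_adjoint ?U * ?U - mat_adjoint ?U * (?U * ?U)"
      using Uc(1) by (intro mult_minus_distrib_mat[of _ n n]) auto
    also have "\<dots> = 1\<^sub>m n - ?U" using Uc(2) unitary_cancel_left(1)[OF U Uc(1)] by simp
    finally have eq: "mat_adjoint ?U * (?U - ?U * ?U) = 1\<^sub>m n - ?U" .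
    have "schatten_norm p (?U - 1\<^sub>m n) = schatten_norm p (1\<^sub>m n - ?U)"
      using Uc(1) by (intro schatten_norm_diff_commute[OF p_ge_1]) auto
    also have "\<dots> \<le> schatten_norm p (?U - ?U * ?U)"
      unfolding eq[symmetric] using Uc(1)
      by (intro schatten_norm_mult_left[OF p_ge_1 _ _ contraction_unitary[OF unitary_adjoint[OF U]]]) auto
    finally show "schatten_norm p (?U - 1\<^sub>m n) \<le> schatten_norm p (\<phi> n (\<one> \<otimes> \<one>) - ?U * ?U)" by simp
  qed
qed

lemma asymp_pow:
  assumes g: "g \<in> carrier G"
  shows "(\<lambda>n. schatten_norm p (\<phi> n (g [^] k) - \<phi> n g ^\<^sub>m k)) \<longlonglongrightarrow> 0"
proof (induction k)
  case 0
  have "\<phi> n g ^\<^sub>m 0 = 1\<^sub>m n" for n using carrier_unitary[OF g, of n] by simp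
  then show ?case using asymp_one by simp
next
  case (Suc k)
  let ?a = "\<lambda>n. schatten_norm p (\<phi> n (g [^] k \<otimes> g) - \<phi> n (g [^] k) * \<phi> n g)"
  let ?b = "\<lambda>n. schatten_norm p (\<phi> n (g [^] k) - \<phi> n g ^\<^sub>m k)"
  have lim: "(\<lambda>n. ?a n + ?b n) \<longlonglongrightarrow> 0"
    using tendsto_add[OF asymp_mult[OF nat_pow_closed[OF g] g] Suc.IH] by simp
  show ?case
  proof (rule tendsto_sandwich[OF _ _ tendsto_const lim])
    show "\<forall>\<^sub>F n in sequentially. 0 \<le> schatten_norm p (\<phi> n (g [^] Suc k) - \<phi> n g ^\<^sub>m Suc k)"
      using unitary_matsD(1)[OF unitary_pow[OF unitary[OF g]]]
      by (intro always_eventually allI schatten_norm_nonneg[OF minus_carrier_mat])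
    show "\<forall>\<^sub>F n in sequentially. schatten_norm p (\<phi> n (g [^] Suc k) - \<phi> n g ^\<^sub>m Suc k) \<le> ?a n + ?b n"
    proof (intro always_eventually allI)
      fix n
      let ?U = "\<phi> n g" and ?V = "\<phi> n (g [^] k)"
      note U = carrier_unitary[OF g, of n] and V = carrier_unitary[OF nat_pow_closed[OF g], of n k]
        and Uk = unitary_matsD(1)[OF unitary_pow[OF unitary[OF g]], of n k]
      have "schatten_norm p (\<phi> n (g [^] Suc k) - ?U ^\<^sub>m Suc k) \<le>
          ?a n + schatten_norm p (?V * ?U - ?U ^\<^sub>m k * ?U)"
        using schatten_norm_diff_triangle[OF p_ge_1, of "\<phi> n (g [^] Suc k)" n n "?V * ?U" "?U ^\<^sub>m Suc k"]
          carrier_unitary[OF nat_pow_closed[OF g], of n "Suc k"] U V Uk by simp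
      also have "?V * ?U - ?U ^\<^sub>m k * ?U = (?V - ?U ^\<^sub>m k) * ?U"
        using U V Uk by (simp add: minus_mult_distrib_mat[of _ n n])
      also have "schatten_norm p ((?V - ?U ^\<^sub>m k) * ?U) \<le> ?b n"
        by (rule schatten_norm_mult_right[OF p_ge_1 minus_carrier_mat[OF Uk] U contraction_unitary[OF unitary[OF g]]])
      finally show "schatten_norm p (\<phi> n (g [^] Suc k) - ?U ^\<^sub>m Suc k) \<le> ?a n + ?b n" by simp
    qed
  qed
qed

text \<open>As \<open>\<phi>\<^sub>n(g)\<^sup>m\<close> approaches \<open>\<phi>\<^sub>n(g\<^sup>m) = \<phi>\<^sub>n(1)\<close> and hence \<open>1\<close>, it is eventually closer to \<open>1\<close> in the
  \<open>p\<close>-norm than \<open>\<phi>\<^sub>n(g)\<close> is. The lower bound on the operator norm is independent of \<open>p\<close>; this is what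
  makes the passage to larger exponents possible.\<close>
lemma torsion_op_norm_gap:
  assumes g: "g \<in> carrier G" and m: "0 < m" "g [^] (m :: nat) = \<one>"
    and sep: "0 < liminf (\<lambda>n. ereal (schatten_norm p (\<phi> n g - 1\<^sub>m n)))"
  shows "\<forall>\<^sub>F n in sequentially. 2 / real m \<le> mat_op_norm (\<phi> n g - 1\<^sub>m n)"
proof -
  obtain \<epsilon> where \<epsilon>: "0 < \<epsilon>" "\<forall>\<^sub>F n in sequentially. \<epsilon> \<le> schatten_norm p (\<phi> n g - 1\<^sub>m n)"
    using sep unfolding liminf_ereal_pos_iff by blast
  have "(\<lambda>n. schatten_norm p (\<phi> n \<one> - \<phi> n g ^\<^sub>m m) + schatten_norm p (\<phi> n \<one> - 1\<^sub>m n)) \<longlonglongrightarrow> 0"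
    using tendsto_add[OF asymp_pow[OF g, of m] asymp_one] m(2) by simp
  then have "\<forall>\<^sub>F n in sequentially.
      schatten_norm p (\<phi> n \<one> - \<phi> n g ^\<^sub>m m) + schatten_norm p (\<phi> n \<one> - 1\<^sub>m n) < \<epsilon>"
    using \<epsilon>(1) by (rule order_tendstoD(2))
  with \<epsilon>(2) show ?thesis
  proof eventually_elim
    case (elim n)
    note U = unitary[OF g, of n]
    note Um = unitary_matsD(1)[OF unitary_pow[OF U, of m]] and V = carrier_unitary[OF one_closed, of n]
    have "schatten_norm p (\<phi> n g ^\<^sub>m m - 1\<^sub>m n) < schatten_norm p (\<phi> n g - 1\<^sub>m n)"
      using elim schatten_norm_diff_triangle[OF p_ge_1 Um V one_carrier_mat]
        schatten_norm_diff_commute[OF p_ge_1 Um V] by simp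
    then show ?case
      using unitary_schatten_dist_le_power[OF p_ge_1 U m(1)] by fastforce
  qed
qed

end

lemma Gp_approximatedE:
  assumes "Gp_approximated p G" "1 \<le> p" "group G"
  obtains \<phi> where "asymptotic_hom G p \<phi>"
    "\<And>g. g \<in> carrier G \<Longrightarrow> g \<noteq> \<one>\<^bsub>G\<^esub> \<Longrightarrow>
      0 < liminf (\<lambda>n. ereal (schatten_norm p (\<phi> n g - 1\<^sub>m n)))"
proof -
  from assms(1) obtain \<phi> where "\<forall>n. \<forall>g\<in>carrier G. \<phi> n g \<in> unitary_mats n"
    "\<forall>g\<in>carrier G. \<forall>h\<in>carrier G.
      (\<lambda>n. schatten_norm p (\<phi> n (g \<otimes>\<^bsub>G\<^esub> h) - \<phi> n g * \<phi> n h)) \<longlonglongrightarrow> 0"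
    "\<forall>g\<in>carrier G - {\<one>\<^bsub>G\<^esub>}. 0 < liminf (\<lambda>n. ereal (schatten_norm p (\<phi> n g - 1\<^sub>m n)))"
    unfolding Gp_approximated_def by blast
  with assms(2,3) show ?thesis
    by (intro that[of \<phi>]) (auto simp: asymptotic_hom_def asymptotic_hom_axioms_def)
qed

lemma Gp_approximatedI:
  assumes "asymptotic_hom G p \<phi>"
    and "\<And>g. g \<in> carrier G \<Longrightarrow> g \<noteq> \<one>\<^bsub>G\<^esub> \<Longrightarrow>
      \<exists>\<epsilon>>0. \<forall>\<^sub>F n in sequentially. \<epsilon> \<le> schatten_norm p (\<phi> n g - 1\<^sub>m n)"
  shows "Gp_approximated p G"
proof -
  interpret asymptotic_hom G p \<phi> by fact
  show ?thesis
    unfolding Gp_approximated_def liminf_ereal_pos_iff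
    using unitary asymp_mult assms(2) by (intro exI[of _ \<phi>]) auto
qed

lemma asymptotic_hom_antimono:
  assumes "asymptotic_hom G p \<phi>" "p \<le> q"
  shows "asymptotic_hom G q \<phi>"
proof -
  interpret asymptotic_hom G p \<phi> by fact
  show ?thesis
  proof
    show "1 \<le> q" using p_ge_1 assms(2) by simp
    fix g h assume g: "g \<in> carrier G" and h: "h \<in> carrier G"
    have c: "\<phi> n (g \<otimes>\<^bsub>G\<^esub> h) - \<phi> n g * \<phi> n h \<in> carrier_mat n n" for n
      by (intro minus_carrier_mat mult_carrier_mat[OF carrier_unitary carrier_unitary] g h)
    show "(\<lambda>n. schatten_norm q (\<phi> n (g \<otimes>\<^bsub>G\<^esub> h) - \<phi> n g * \<phi> n h)) \<longlonglongrightarrow> 0"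
      by (rule tendsto_sandwich[OF _ _ tendsto_const asymp_mult[OF g h]];
          intro always_eventually allI schatten_norm_nonneg[OF c] schatten_norm_antimono[OF p_ge_1 assms(2) c])
  qed (use unitary in blast)
qed

text \<open>The sizes of the two summands have to add up to \<open>n\<close>, so both sequences are reindexed, along maps
  that tend to infinity.\<close>
lemma asymptotic_hom_dsum:
  assumes \<phi>: "asymptotic_hom G q \<phi>" and \<psi>: "asymptotic_hom H q \<psi>" and \<pi>: "\<pi> \<in> hom G H"
    and ab: "\<And>n. a n + b n = n"
    and a: "filterlim a sequentially sequentially" and b: "filterlim b sequentially sequentially"
  shows "asymptotic_hom G q (\<lambda>n g. mat_dsum (\<phi> (a n) g) (\<psi> (b n) (\<pi> g)))"
proof -
  interpret \<phi>: asymptotic_hom G q \<phi> by fact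
  interpret \<psi>: asymptotic_hom H q \<psi> by fact
  note \<pi>c = hom_in_carrier[OF \<pi>]
  show ?thesis
  proof
    show "1 \<le> q" by (rule \<phi>.p_ge_1)
    show "mat_dsum (\<phi> (a n) g) (\<psi> (b n) (\<pi> g)) \<in> unitary_mats n" if "g \<in> carrier G" for n g
      using mat_dsum_unitary[OF \<phi>.unitary[OF that] \<psi>.unitary[OF \<pi>c[OF that]], of "a n" "b n"] ab by simp
    fix g h assume g: "g \<in> carrier G" and h: "h \<in> carrier G"
    let ?A = "\<lambda>n. \<phi> n (g \<otimes>\<^bsub>G\<^esub> h) - \<phi> n g * \<phi> n h"
    let ?B = "\<lambda>n. \<psi> n (\<pi> g \<otimes>\<^bsub>H\<^esub> \<pi> h) - \<psi> n (\<pi> g) * \<psi> n (\<pi> h)"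
    have A: "?A n \<in> carrier_mat n n" for n
      by (intro minus_carrier_mat mult_carrier_mat[OF \<phi>.carrier_unitary \<phi>.carrier_unitary] g h)
    have B: "?B n \<in> carrier_mat n n" for n
      by (intro minus_carrier_mat mult_carrier_mat[OF \<psi>.carrier_unitary \<psi>.carrier_unitary] \<pi>c g h)
    have eq: "mat_dsum (\<phi> (a n) (g \<otimes>\<^bsub>G\<^esub> h)) (\<psi> (b n) (\<pi> (g \<otimes>\<^bsub>G\<^esub> h))) -
        mat_dsum (\<phi> (a n) g) (\<psi> (b n) (\<pi> g)) * mat_dsum (\<phi> (a n) h) (\<psi> (b n) (\<pi> h)) =
        mat_dsum (?A (a n)) (?B (b n))" for n
    proof -
      note c = \<phi>.carrier_unitary[OF g, of "a n"] \<phi>.carrier_unitary[OF h, of "a n"]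
        \<psi>.carrier_unitary[OF \<pi>c[OF g], of "b n"] \<psi>.carrier_unitary[OF \<pi>c[OF h], of "b n"]
        \<phi>.carrier_unitary[OF \<phi>.m_closed[OF g h], of "a n"]
        \<psi>.carrier_unitary[OF \<psi>.m_closed[OF \<pi>c[OF g] \<pi>c[OF h]], of "b n"]
      show ?thesis
        unfolding hom_mult[OF \<pi> g h] mat_dsum_mult[OF c(1,2,3,4)]
        by (rule mat_dsum_minus[OF c(5) mult_carrier_mat[OF c(1,2)] c(6) mult_carrier_mat[OF c(3,4)]])
    qed
    have lim: "(\<lambda>n. schatten_norm q (?A (a n)) + schatten_norm q (?B (b n))) \<longlonglongrightarrow> 0"
      using tendsto_add[OF filterlim_compose[OF \<phi>.asymp_mult[OF g h] a]
          filterlim_compose[OF \<psi>.asymp_mult[OF \<pi>c[OF g] \<pi>c[OF h]] b]] by simp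
    show "(\<lambda>n. schatten_norm q (mat_dsum (\<phi> (a n) (g \<otimes>\<^bsub>G\<^esub> h)) (\<psi> (b n) (\<pi> (g \<otimes>\<^bsub>G\<^esub> h))) -
        mat_dsum (\<phi> (a n) g) (\<psi> (b n) (\<pi> g)) * mat_dsum (\<phi> (a n) h) (\<psi> (b n) (\<pi> h)))) \<longlonglongrightarrow> 0"
      unfolding eq
      by (rule tendsto_sandwich[OF _ _ tendsto_const lim]; intro always_eventually allI
          schatten_norm_nonneg[OF mat_dsum_carrier[OF A B]] schatten_norm_dsum(3)[OF \<phi>.p_ge_1 A B])
  qed
qed

theorem proposition1p7:
  fixes p q :: ereal
    and \<Gamma> :: "('a, 'b) monoid_scheme"
    and N :: "'a set"
  assumes "1 \<le> p" and "p \<le> q" and "q \<le> \<infinity>"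
    and "fin_gen_group \<Gamma>"
    and "N \<lhd> \<Gamma>" and "finite N"
    and "Gp_approximated q (\<Gamma> Mod N)"
    and "Gp_approximated p \<Gamma>"
  shows "Gp_approximated q \<Gamma>"
proof -
  have q: "1 \<le> q" using assms(1,2) by simp
  interpret N: normal N \<Gamma> by fact
  obtain \<phi> where \<phi>: "asymptotic_hom \<Gamma> p \<phi>"
    and \<phi>_sep: "\<And>g. g \<in> carrier \<Gamma> \<Longrightarrow> g \<noteq> \<one>\<^bsub>\<Gamma>\<^esub> \<Longrightarrow>
      0 < liminf (\<lambda>n. ereal (schatten_norm p (\<phi> n g - 1\<^sub>m n)))"
    using Gp_approximatedE[OF assms(8,1) N.is_group] by blast
  obtain \<psi> where \<psi>: "asymptotic_hom (\<Gamma> Mod N) q \<psi>"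
    and \<psi>_sep: "\<And>g. g \<in> carrier (\<Gamma> Mod N) \<Longrightarrow> g \<noteq> \<one>\<^bsub>\<Gamma> Mod N\<^esub> \<Longrightarrow>
      0 < liminf (\<lambda>n. ereal (schatten_norm q (\<psi> n g - 1\<^sub>m n)))"
    using Gp_approximatedE[OF assms(7) q N.factorgroup_is_group] by blast
  interpret \<phi>: asymptotic_hom \<Gamma> p \<phi> by fact
  interpret \<psi>: asymptotic_hom "\<Gamma> Mod N" q \<psi> by fact
  define \<pi> where "\<pi> g = N #>\<^bsub>\<Gamma>\<^esub> g" for g
  have \<pi>: "\<pi> \<in> hom \<Gamma> (\<Gamma> Mod N)" using N.r_coset_hom_Mod by (simp add: \<pi>_def[abs_def])
  \<comment> \<open>Half of the dimension goes to each summand.\<close>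
  define a b :: "nat \<Rightarrow> nat" where "a n = n - n div 2" and "b n = n div 2" for n
  have ab: "a n + b n = n" for n by (simp add: a_def b_def)
  have "n div 2 \<le> a n" for n by (simp add: a_def)
  moreover have "filterlim (\<lambda>n::nat. n div 2) sequentially sequentially"
    unfolding filterlim_at_top
  proof
    fix Z :: nat
    show "\<forall>\<^sub>F n in sequentially. Z \<le> n div 2"
      using eventually_ge_at_top[of "2 * Z"] by eventually_elim auto
  qed
  ultimately have a: "filterlim a sequentially sequentially" and b: "filterlim b sequentially sequentially"
    by (auto simp: b_def[abs_def] intro: filterlim_at_top_mono)
  define \<chi> where "\<chi> n g = mat_dsum (\<phi> (a n) g) (\<psi> (b n) (\<pi> g))" for n g
  have "asymptotic_hom \<Gamma> q \<chi>"
    using asymptotic_hom_dsum[OF asymptotic_hom_antimono[OF \<phi> assms(2)] \<psi> \<pi> ab a b]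
    by (simp add: \<chi>_def[abs_def])
  then show ?thesis
  proof (rule Gp_approximatedI)
    fix g assume g: "g \<in> carrier \<Gamma>" "g \<noteq> \<one>\<^bsub>\<Gamma>\<^esub>"
    have \<pi>g: "\<pi> g \<in> carrier (\<Gamma> Mod N)" using hom_in_carrier[OF \<pi>] g by blast
    note c = \<phi>.carrier_unitary[OF g(1)] \<psi>.carrier_unitary[OF \<pi>g]
    have \<chi>1: "\<chi> n g - 1\<^sub>m n = mat_dsum (\<phi> (a n) g - 1\<^sub>m (a n)) (\<psi> (b n) (\<pi> g) - 1\<^sub>m (b n))" for n
      using mat_dsum_minus[OF c(1) one_carrier_mat c(2) one_carrier_mat, of "a n" "b n"]
      by (simp add: \<chi>_def mat_dsum_one ab)
    have ge_\<phi>: "schatten_norm q (\<phi> (a n) g - 1\<^sub>m (a n)) \<le> schatten_norm q (\<chi> n g - 1\<^sub>m n)" for n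
      unfolding \<chi>1 by (rule schatten_norm_dsum(1)[OF q]) (rule minus_carrier_mat[OF one_carrier_mat])+
    have ge_\<psi>: "schatten_norm q (\<psi> (b n) (\<pi> g) - 1\<^sub>m (b n)) \<le> schatten_norm q (\<chi> n g - 1\<^sub>m n)" for n
      unfolding \<chi>1 by (rule schatten_norm_dsum(2)[OF q]) (rule minus_carrier_mat[OF one_carrier_mat])+
    show "\<exists>\<epsilon>>0. \<forall>\<^sub>F n in sequentially. \<epsilon> \<le> schatten_norm q (\<chi> n g - 1\<^sub>m n)"
    proof (cases "g \<in> N")
      case False
      have "\<pi> g \<noteq> \<one>\<^bsub>\<Gamma> Mod N\<^esub>"
        using False g N.rcos_self[OF g(1) N.is_subgroup] by (auto simp: \<pi>_def FactGroup_def)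
      then obtain \<epsilon> where "0 < \<epsilon>" "\<forall>\<^sub>F n in sequentially. \<epsilon> \<le> schatten_norm q (\<psi> n (\<pi> g) - 1\<^sub>m n)"
        using \<psi>_sep[OF \<pi>g] unfolding liminf_ereal_pos_iff by blast
      then have "\<forall>\<^sub>F n in sequentially. \<epsilon> \<le> schatten_norm q (\<psi> (b n) (\<pi> g) - 1\<^sub>m (b n))"
        using b eventually_compose_filterlim by fast
      then have "\<forall>\<^sub>F n in sequentially. \<epsilon> \<le> schatten_norm q (\<chi> n g - 1\<^sub>m n)"
        by eventually_elim (use ge_\<psi> order.trans in blast)
      then show ?thesis using \<open>0 < \<epsilon>\<close> by blast
    next
      case True
      \<comment> \<open>The order of \<open>g\<close> divides the order of the finite group \<open>N\<close>.\<close>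
      define m where "m = card N"
      have m: "0 < m" using True assms(6) by (auto simp: m_def card_gt_0_iff)
      interpret NN: group "\<Gamma>\<lparr>carrier := N\<rparr>"
        using N.subgroup_is_group N.is_group by blast
      have "g [^]\<^bsub>\<Gamma>\<lparr>carrier := N\<rparr>\<^esub> Coset.order (\<Gamma>\<lparr>carrier := N\<rparr>) = \<one>\<^bsub>\<Gamma>\<lparr>carrier := N\<rparr>\<^esub>"
        using True by (intro NN.pow_order_eq_1) simp
      then have gm: "g [^]\<^bsub>\<Gamma>\<^esub> m = \<one>\<^bsub>\<Gamma>\<^esub>"
        by (simp add: N.nat_pow_consistent[symmetric] Coset.order_def m_def)
      have "\<forall>\<^sub>F n in sequentially. 2 / real m \<le> mat_op_norm (\<phi> n g - 1\<^sub>m n)"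
        by (rule \<phi>.torsion_op_norm_gap[OF g(1) m gm \<phi>_sep[OF g]])
      then have "\<forall>\<^sub>F n in sequentially. 2 / real m \<le> schatten_norm q (\<phi> n g - 1\<^sub>m n)"
      proof eventually_elim
        case (elim n)
        also have "mat_op_norm (\<phi> n g - 1\<^sub>m n) \<le> schatten_norm q (\<phi> n g - 1\<^sub>m n)"
          using schatten_norm_antimono[OF q assms(3) minus_carrier_mat[OF one_carrier_mat]]
          unfolding schatten_norm_infinity .
        finally show ?case .
      qed
      then have "\<forall>\<^sub>F n in sequentially. 2 / real m \<le> schatten_norm q (\<phi> (a n) g - 1\<^sub>m (a n))"
        using a eventually_compose_filterlim by fast
      then have "\<forall>\<^sub>F n in sequentially. 2 / real m \<le> schatten_norm q (\<chi> n g - 1\<^sub>m n)"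
        by eventually_elim (use ge_\<phi> order.trans in blast)
      then show ?thesis using m by (intro exI[of _ "2 / real m"]) auto
    qed
  qed
qed

end
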